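(* Let $0\leq\alpha\leq\rho$, $\rho>0$, $0<\gamma<\sigma\leq 1$, $\delta\in\{-1,1\}$, $p>1$ and $\frac1p+\frac1q=1$. Suppose there exists $n_0\in\mathbf N$ such that $\nu_n\geq\nu_{n+1}$ for all $n\in\{n_0,n_0+1,\dots\}$, and $U(\infty)=V(\infty)=\infty$. Define operators $T_1:L_{p,\Phi_\delta}(\mathbf R_+)\to l_{p,\widetilde\Psi^{1-p}}$ and $T_2:l_{q,\widetilde\Psi}\to L_{q,\Phi_\delta^{1-q}}(\mathbf R_+)$ by $$(T_1f)_n:=\int_0^\infty H_\delta(x,n)f(x)\,dx\quad(n\in\mathbf N),\qquad (T_2a)(x):=\sum_{n=1}^\infty H_\delta(x,n)a_n\quad(x\in\mathbf R_+).$$ Then their operator norms $$\|T_1\|:=\sup_{f\neq 0}\frac{\|T_1f\|_{p,\widetilde\Psi^{1-p}}}{\|f\|_{p,\Phi_\delta}},\qquad \|T_2\|:=\sup_{a\neq0}\frac{\|T_2a\|_{q,\Phi_\delta^{1-q}}}{\|a\|_{q,\widetilde\Psi}}$$ (suprema over nonzero $f\in L_{p,\Phi_\delta}(\mathbf R_+)$ and nonzero $a\in l_{q,\widetilde\Psi}$) satisfy $$\|T_1\|=\|T_2\|=k(\sigma)=\frac{2\Gamma(\frac\sigma\gamma)}{\gamma(2\rho)^{\sigma/\gamma}}\zeta\Big(\frac\sigma\gamma,\frac{\alpha+\rho}{2\rho}\Big).$$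
   Context: $\mathbf{N}=\{1,2,\dots\}$, $\mathbf{R}_+=(0,\infty)$. $\nu_n>0$ ($n\in\mathbf N$) are given reals, $V_n:=\sum_{j=1}^n\nu_j$, $\widetilde\nu_n\in[0,\frac{\nu_n}{2}]$, $\widetilde V_n:=V_n-\widetilde\nu_n$. $\mu$ is a positive continuous function on $\mathbf R_+$ with $U(x):=\int_0^x\mu(t)\,dt<\infty$ for $x\in[0,\infty)$, and $U(\infty):=\int_0^\infty\mu(t)\,dt$. $\nu(t):=\nu_n$ for $t\in(n-\frac12,n+\frac12]$, $V(y):=\int_{1/2}^y\nu(t)\,dt$ for $y\ge\frac12$, and $V(\infty):=\lim_{y\to\infty}V(y)=\sum_{n=1}^\infty\nu_n$. Powers such as $U^{s}(x)$ mean $(U(x))^{s}$. Functions are real-valued and measurable, identified when equal almost everywhere. $\operatorname{csch}(u):=\frac{2}{e^u-e^{-u}}$ for $u>0$. The kernel is $$H_\delta(x,n):=\frac{\operatorname{csch}\big(\rho(U^\delta(x)\widetilde V_n)^\gamma\big)}{e^{\alpha(U^\delta(x)\widetilde V_n)^\gamma}}.$$ $\Phi_\delta(x):=\frac{U^{p(1-\delta\sigma)-1}(x)}{\mu^{p-1}(x)}$, $\widetilde\Psi(n):=\frac{\widetilde V_n^{q(1-\sigma)-1}}{\nu_n^{q-1}}$, so that $\widetilde\Psi^{1-p}(n)=\frac{\nu_n}{\widetilde V_n^{1-p\sigma}}$ and $\Phi_\delta^{1-q}(x)=\frac{\mu(x)}{U^{1-q\delta\sigma}(x)}$. For $r>1$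 and a positive weight $w$ on $\mathbf R_+$ (respectively on $\mathbf N$), $\|f\|_{r,w}:=(\int_0^\infty w(x)|f(x)|^r dx)^{1/r}$ and $L_{r,w}(\mathbf R_+):=\{f:\|f\|_{r,w}<\infty\}$ (respectively $\|a\|_{r,w}:=(\sum_{n=1}^\infty w(n)|a_n|^r)^{1/r}$ and $l_{r,w}:=\{a:\|a\|_{r,w}<\infty\}$). $$k(\sigma):=\int_0^\infty\frac{\operatorname{csch}(\rho t^\gamma)}{e^{\alpha t^\gamma}}t^{\sigma-1}dt.$$ $\zeta(s,a):=\sum_{k=0}^\infty\frac1{(k+a)^s}$ ($s>1$, $0<a\le1$) is the Hurwitz zeta function and $\Gamma$ is the Gamma function. *)

theory Defs
  imports "HOL-Analysis.Analysis"
begin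

definition csch :: "real \<Rightarrow> real" where
  "csch u = 2 / (exp u - exp (- u))"

definition hurwitz_zeta :: "real \<Rightarrow> real \<Rightarrow> real" where
  "hurwitz_zeta s a = (\<Sum>k. 1 / (real k + a) powr s)"

text \<open>Sequences indexed by \<open>{1, 2, \<dots>}\<close> are functions on \<^typ>\<open>nat\<close> whose value at \<open>0\<close> is never
  used; series over \<open>n \<ge> 1\<close> are written as series over \<open>Suc n\<close>. All powers have real exponents
  and, for \<open>x > 0\<close> and \<open>n \<ge> 1\<close>, nonnegative bases.\<close>

definition U_fun :: "(real \<Rightarrow> real) \<Rightarrow> real \<Rightarrow> real" where
  "U_fun \<mu> x = (LBINT t:{0<..x}. \<mu> t)"

definition U_infinity :: "(real \<Rightarrow> real) \<Rightarrow> ennreal" where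
  "U_infinity \<mu> = (\<integral>\<^sup>+t\<in>{0<..}. ennreal (\<mu> t) \<partial>lborel)"

definition V_seq :: "(nat \<Rightarrow> real) \<Rightarrow> nat \<Rightarrow> real" where
  "V_seq \<nu> n = (\<Sum>j=1..n. \<nu> j)"

definition V_tilde :: "(nat \<Rightarrow> real) \<Rightarrow> (nat \<Rightarrow> real) \<Rightarrow> nat \<Rightarrow> real" where
  "V_tilde \<nu> \<nu>t n = V_seq \<nu> n - \<nu>t n"

text \<open>For \<open>t > 1/2\<close>, the \<open>n\<close> with \<open>t \<in> (n - 1/2, n + 1/2]\<close> is \<open>\<lceil>t - 1/2\<rceil>\<close>.\<close>

definition nu_step :: "(nat \<Rightarrow> real) \<Rightarrow> real \<Rightarrow> real" where
  "nu_step \<nu> t = \<nu> (nat \<lceil>t - 1/2\<rceil>)"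

definition V_fun :: "(nat \<Rightarrow> real) \<Rightarrow> real \<Rightarrow> real" where
  "V_fun \<nu> y = (LBINT t:{1/2<..y}. nu_step \<nu> t)"

definition kernel_H ::
  "real \<Rightarrow> real \<Rightarrow> real \<Rightarrow> real \<Rightarrow> (real \<Rightarrow> real) \<Rightarrow> (nat \<Rightarrow> real) \<Rightarrow> real \<Rightarrow> nat \<Rightarrow> real" where
  "kernel_H \<alpha> \<rho> \<gamma> \<delta> U W x n =
     csch (\<rho> * (U x powr \<delta> * W n) powr \<gamma>) / exp (\<alpha> * (U x powr \<delta> * W n) powr \<gamma>)"

definition weight_Phi ::
  "real \<Rightarrow> real \<Rightarrow> real \<Rightarrow> (real \<Rightarrow> real) \<Rightarrow> (real \<Rightarrow> real) \<Rightarrow> real \<Rightarrow> real" where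
  "weight_Phi p \<sigma> \<delta> \<mu> U x = U x powr (p * (1 - \<delta> * \<sigma>) - 1) / \<mu> x powr (p - 1)"

definition weight_Psi ::
  "real \<Rightarrow> real \<Rightarrow> (nat \<Rightarrow> real) \<Rightarrow> (nat \<Rightarrow> real) \<Rightarrow> nat \<Rightarrow> real" where
  "weight_Psi q \<sigma> \<nu> W n = W n powr (q * (1 - \<sigma>) - 1) / \<nu> n powr (q - 1)"

definition k_const :: "real \<Rightarrow> real \<Rightarrow> real \<Rightarrow> real \<Rightarrow> real" where
  "k_const \<alpha> \<rho> \<gamma> \<sigma> =
     (LBINT t:{0<..}. csch (\<rho> * t powr \<gamma>) / exp (\<alpha> * t powr \<gamma>) * t powr (\<sigma> - 1))"

text \<open>The norms below are real-valued and meaningful on the corresponding spaces only. Elements of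
  \<open>wLp r w\<close> are representatives: functions on the whole line of which only the restriction to
  \<open>(0, \<infinity>)\<close> matters, up to null sets.\<close>

definition wLp :: "real \<Rightarrow> (real \<Rightarrow> real) \<Rightarrow> (real \<Rightarrow> real) set" where
  "wLp r w = {f \<in> borel_measurable (lebesgue_on {0<..}).
     integrable (lebesgue_on {0<..}) (\<lambda>x. w x * \<bar>f x\<bar> powr r)}"

definition wLp_norm :: "real \<Rightarrow> (real \<Rightarrow> real) \<Rightarrow> (real \<Rightarrow> real) \<Rightarrow> real" where
  "wLp_norm r w f = (LINT x|lebesgue_on {0<..}. w x * \<bar>f x\<bar> powr r) powr (1 / r)"

definition wlp :: "real \<Rightarrow> (nat \<Rightarrow> real) \<Rightarrow> (nat \<Rightarrow> real) set" where
  "wlp r w = {a. summable (\<lambda>n. w (Suc n) * \<bar>a (Suc n)\<bar> powr r)}"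

definition wlp_norm :: "real \<Rightarrow> (nat \<Rightarrow> real) \<Rightarrow> (nat \<Rightarrow> real) \<Rightarrow> real" where
  "wlp_norm r w a = (\<Sum>n. w (Suc n) * \<bar>a (Suc n)\<bar> powr r) powr (1 / r)"

definition T1 :: "(real \<Rightarrow> nat \<Rightarrow> real) \<Rightarrow> (real \<Rightarrow> real) \<Rightarrow> nat \<Rightarrow> real" where
  "T1 H f n = (LINT x|lebesgue_on {0<..}. H x n * f x)"

definition T2 :: "(real \<Rightarrow> nat \<Rightarrow> real) \<Rightarrow> (nat \<Rightarrow> real) \<Rightarrow> real \<Rightarrow> real" where
  "T2 H a x = (\<Sum>n. H x (Suc n) * a (Suc n))"

text \<open>Operator norms are suprema in the extended reals, so that unboundedness would show up as the
  value \<open>\<infinity>\<close>.\<close>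

definition T1_norm ::
  "real \<Rightarrow> (real \<Rightarrow> real) \<Rightarrow> (nat \<Rightarrow> real) \<Rightarrow> (real \<Rightarrow> nat \<Rightarrow> real) \<Rightarrow> ereal" where
  "T1_norm p w v H =
     (SUP f \<in> {f \<in> wLp p w. \<not> (AE x in lebesgue_on {0<..}. f x = 0)}.
        ereal (wlp_norm p v (T1 H f) / wLp_norm p w f))"

definition T2_norm ::
  "real \<Rightarrow> (nat \<Rightarrow> real) \<Rightarrow> (real \<Rightarrow> real) \<Rightarrow> (real \<Rightarrow> nat \<Rightarrow> real) \<Rightarrow> ereal" where
  "T2_norm q v w H =
     (SUP a \<in> {a \<in> wlp q v. \<exists>n\<ge>1. a n \<noteq> 0}.
        ereal (wLp_norm q w (T2 H a) / wlp_norm q v a))"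

end

theory Submission
  imports Defs
begin

text \<open>
  Write \<open>K(t)\<close> for the function \<open>csch(\<rho> t^\<gamma>) / exp(\<alpha> t^\<gamma>)\<close>, so that the kernel is
  \<open>K(U(x)^\<delta> W\<^sub>n)\<close> with \<open>W\<^sub>n = V\<^sub>n - \<nu>t\<^sub>n\<close>. In the coordinates \<open>s = \<delta> ln U(x)\<close> and \<open>y = ln W\<^sub>n\<close> it
  depends on \<open>s + y\<close> only: the operators are convolutions. The powers of \<open>U\<close>, \<open>\<mu>\<close>, \<open>W\<close> and \<open>\<nu>\<close> in the
  weights are exactly those which, after the substitutions
  \<open>f = \<mu> U^(\<delta>\<sigma> - 1) \<phi>\<close> and \<open>a\<^sub>n = \<nu>\<^sub>n W\<^sub>n^(\<sigma> - 1) b\<^sub>n\<close>, turn the four weighted norms into plain \<open>L\<^sup>p\<close> and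
  \<open>L\<^sup>q\<close> norms for the measure \<open>M = (\<mu>/U) dx\<close> and the measure \<open>N\<close> with mass \<open>\<nu>\<^sub>n/W\<^sub>n\<close> at \<open>n\<close>, and turn \<open>T1\<close> and \<open>T2\<close> into
  transposes of each other with the kernel \<open>G(s + y)\<close>, where \<open>G(s) = K(e^s) e^(\<sigma>s)\<close> (\<open>log_kern\<close>).
  Because \<open>U\<close> increases from \<open>0\<close> to \<open>\<infinity>\<close>, the map \<open>x \<mapsto> \<delta> ln U(x)\<close> carries \<open>M\<close> to Lebesgue measure on the
  whole line, for both signs of \<open>\<delta>\<close> (\<open>distr_log_primitive\<close>).

  Upper bounds. By the Schur test (\<open>schur_test\<close>) it suffices that both marginals of the kernel are at
  most \<open>k(\<sigma>)\<close>. The marginal over \<open>M\<close> is \<open>\<integral> G = k(\<sigma>)\<close> by translation invariance. The marginal over \<open>N\<close> is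
  the sum \<open>\<Sum> \<nu>\<^sub>n g(W\<^sub>n)\<close> with \<open>g(v) = G(s + ln v) / v\<close>, and \<open>g\<close> is decreasing and convex:
  expanding \<open>csch\<close> in a geometric series makes it a sum of exponentials of convex functions of \<open>v\<close>. As
  \<open>W\<^sub>n\<close> is at least the midpoint of \<open>[V\<^sub>n\<^sub>-\<^sub>1, V\<^sub>n]\<close>, the Hermite-Hadamard inequality bounds the
  sum by \<open>\<integral> g = k(\<sigma>)\<close> (\<open>log_kern_suminf_le\<close>).

  Lower bounds. Test \<open>T1\<close> on \<open>\<phi> = exp(\<epsilon>s/p)\<close> restricted to \<open>s \<le> 0\<close>, whose \<open>p\<close>-th power has integral
  \<open>1/\<epsilon>\<close>. On a fixed window \<open>[-R, R]\<close> carrying almost all of \<open>\<integral> G\<close> the image at \<open>n\<close> is about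
  \<open>k(\<sigma>) W\<^sub>n^(-\<epsilon>/p)\<close> as soon as \<open>W\<^sub>n \<ge> e^R\<close>, and \<open>\<Sum> \<nu>\<^sub>n W\<^sub>n^(-1 - \<epsilon>)\<close> over these \<open>n\<close> is at least
  \<open>V^(-\<epsilon>)/\<epsilon>\<close> for a fixed \<open>V\<close>; here the eventual monotonicity of \<open>\<nu>\<close> and the divergence of \<open>V\<close> enter.
  Letting \<open>\<epsilon>\<close> tend to \<open>0\<close> gives \<open>k(\<sigma>)\<close> (\<open>near_extremal\<close>). For \<open>T2\<close> the
  sequence dual to \<open>T1 f\<close>, that is its power \<open>p - 1\<close>, is equally good (\<open>dual_extremal\<close>).

  The closed form of \<open>k(\<sigma>)\<close> results from integrating the geometric series termwise: each term is a
  Gamma integral.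
\<close>

section \<open>The Schur test and duality\<close>

text \<open>The bounds on the two factors are real numbers, so that no power of an extended real is ever taken.\<close>
lemma holder_nn_integral:
  fixes f g :: "'a \<Rightarrow> real"
  assumes pq: "1 < p" "1 < q" "1 / p + 1 / q = 1"
    and [measurable]: "f \<in> borel_measurable M" "g \<in> borel_measurable M"
    and nonneg: "\<And>x. 0 \<le> f x" "\<And>x. 0 \<le> g x" "0 \<le> A" "0 \<le> B"
    and fA: "(\<integral>\<^sup>+x. ennreal (f x powr p) \<partial>M) \<le> ennreal A"
    and gB: "(\<integral>\<^sup>+x. ennreal (g x powr q) \<partial>M) \<le> ennreal B"
  shows "(\<integral>\<^sup>+x. ennreal (f x * g x) \<partial>M) \<le> ennreal (A powr (1 / p) * B powr (1 / q))"
proof (cases "A = 0 \<or> B = 0")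
  case True
  have "AE x in M. f x * g x = 0"
    using True
  proof
    assume "A = 0"
    then have "(\<integral>\<^sup>+x. ennreal (f x powr p) \<partial>M) = 0" using fA by simp
    then have "AE x in M. ennreal (f x powr p) = 0" by (subst (asm) nn_integral_0_iff_AE) auto
    then show ?thesis by eventually_elim (use pq nonneg in auto)
  next
    assume "B = 0"
    then have "(\<integral>\<^sup>+x. ennreal (g x powr q) \<partial>M) = 0" using gB by simp
    then have "AE x in M. ennreal (g x powr q) = 0" by (subst (asm) nn_integral_0_iff_AE) auto
    then show ?thesis by eventually_elim (use pq nonneg in auto)
  qed
  then have "(\<integral>\<^sup>+x. ennreal (f x * g x) \<partial>M) = (\<integral>\<^sup>+x. 0 \<partial>M)"
    by (intro nn_integral_cong_AE) auto
  then show ?thesis by simp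
next
  case False
  then have AB: "0 < A" "0 < B" using nonneg by auto
  define a b where "a = A powr (1 / p)" and "b = B powr (1 / q)"
  have ab: "0 < a" "0 < b" "a powr p = A" "b powr q = B"
    using AB pq by (auto simp: a_def b_def powr_powr)
  \<comment> \<open>Young's inequality for the normalised functions \<open>f / a\<close> and \<open>g / b\<close>.\<close>
  have young: "f x * g x \<le> (a * b / (p * A)) * f x powr p + (a * b / (q * B)) * g x powr q" for x
  proof -
    have "(f x / a) * (g x / b) \<le> (f x / a) powr p / p + (g x / b) powr q / q"
      using pq nonneg ab by (intro Youngs_inequality) auto
    also have "\<dots> = f x powr p / (p * A) + g x powr q / (q * B)"
      using ab nonneg pq by (simp add: powr_divide mult.commute)
    finally have "f x * g x / (a * b) \<le> f x powr p / (p * A) + g x powr q / (q * B)" by simp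
    then have "f x * g x \<le> (a * b) * (f x powr p / (p * A) + g x powr q / (q * B))"
      using ab by (subst (asm) pos_divide_le_eq) (auto simp: mult.commute)
    then show ?thesis by (simp add: algebra_simps)
  qed
  have "(\<integral>\<^sup>+x. ennreal (f x * g x) \<partial>M) \<le>
      (\<integral>\<^sup>+x. ennreal (a * b / (p * A)) * ennreal (f x powr p) + ennreal (a * b / (q * B)) * ennreal (g x powr q) \<partial>M)"
  proof (intro nn_integral_mono)
    fix x
    show "ennreal (f x * g x) \<le> ennreal (a * b / (p * A)) * ennreal (f x powr p) + ennreal (a * b / (q * B)) * ennreal (g x powr q)"
      using young[of x] ab AB pq
      by (simp add: ennreal_mult[symmetric] ennreal_plus[symmetric] ennreal_leI del: ennreal_plus)
  qed
  also have "\<dots> = ennreal (a * b / (p * A)) * (\<integral>\<^sup>+x. ennreal (f x powr p) \<partial>M)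
      + ennreal (a * b / (q * B)) * (\<integral>\<^sup>+x. ennreal (g x powr q) \<partial>M)"
    by (simp add: nn_integral_add nn_integral_cmult)
  also have "\<dots> \<le> ennreal (a * b / (p * A)) * ennreal A + ennreal (a * b / (q * B)) * ennreal B"
    by (intro add_mono mult_left_mono fA gB) auto
  also have "\<dots> = ennreal (a * b * (1 / p + 1 / q))"
    using ab AB pq
    by (simp add: ennreal_mult[symmetric] ennreal_plus[symmetric] field_simps del: ennreal_plus)
  finally show ?thesis using pq by (simp add: a_def b_def)
qed

lemma conjugate_exponent:
  fixes p q :: real
  assumes "1 < p" "1 / p + 1 / q = 1"
  shows "1 < q" "(p - 1) * q = p" "p / q = p - 1"
proof -
  have "q \<noteq> 0" using assms by auto
  then have *: "q + p = p * q" using assms by (simp add: field_simps)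
  then have "(p - 1) * q = p" by (simp add: algebra_simps)
  then show "(p - 1) * q = p" .
  then show "p / q = p - 1" using \<open>q \<noteq> 0\<close> by (simp add: field_simps)
  have "q * (p - 1) = (p - 1) + 1" using * by (simp add: algebra_simps)
  then have "(q - 1) * (p - 1) > 0" by (simp add: algebra_simps)
  then show "1 < q" using assms by (simp add: zero_less_mult_iff)
qed

text \<open>
  Schur's test with constant weights. Hoelder's inequality for \<open>k \<phi> = (k^(1/p) \<phi>) k^(1/q)\<close> gives
  \<open>\<bar>\<integral> k \<phi>\<bar>^p \<le> C^(p - 1) \<integral> k \<bar>\<phi>\<bar>^p\<close> pointwise, and Tonelli's theorem together with the other marginal does the rest.
  The pointwise bound \<open>B\<close> makes the integrals over \<open>M\<close> converge for every \<open>y\<close> rather than for almost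
  every one, which is what a series at each point \<open>x\<close> requires.
\<close>
lemma schur_test:
  fixes k :: "'a \<Rightarrow> 'b \<Rightarrow> real" and \<phi> :: "'a \<Rightarrow> real"
  assumes pair: "pair_sigma_finite M N"
    and pq: "1 < p" "1 / p + 1 / q = 1"
    and k_meas: "case_prod k \<in> borel_measurable (M \<Otimes>\<^sub>M N)"
    and k_bounds: "\<And>x y. 0 \<le> k x y" "\<And>x y. k x y \<le> B"
    and "0 \<le> C"
    and marg_M: "\<And>y. y \<in> space N \<Longrightarrow> (\<integral>\<^sup>+x. ennreal (k x y) \<partial>M) \<le> ennreal C"
    and marg_N: "\<And>x. x \<in> space M \<Longrightarrow> (\<integral>\<^sup>+y. ennreal (k x y) \<partial>N) \<le> ennreal C"
    and \<phi>_meas [measurable]: "\<phi> \<in> borel_measurable M"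
    and \<phi>_int: "integrable M (\<lambda>x. \<bar>\<phi> x\<bar> powr p)"
  shows "\<And>y. y \<in> space N \<Longrightarrow> integrable M (\<lambda>x. k x y * \<phi> x)"
    and "integrable N (\<lambda>y. \<bar>\<integral>x. k x y * \<phi> x \<partial>M\<bar> powr p)"
    and "(\<integral>y. \<bar>\<integral>x. k x y * \<phi> x \<partial>M\<bar> powr p \<partial>N) \<le> C powr p * (\<integral>x. \<bar>\<phi> x\<bar> powr p \<partial>M)"
proof -
  interpret pair_sigma_finite M N by fact
  note k_meas [measurable]
  have k1 [measurable]: "(\<lambda>x. k x y) \<in> borel_measurable M" if "y \<in> space N" for y
    using that by measurable
  note q = conjugate_exponent[OF pq]
  define I where "I y = (\<integral>x. k x y * \<bar>\<phi> x\<bar> powr p \<partial>M)" for y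
  have I_int: "integrable M (\<lambda>x. k x y * \<bar>\<phi> x\<bar> powr p)" if "y \<in> space N" for y
  proof (rule Bochner_Integration.integrable_bound)
    show "integrable M (\<lambda>x. B * \<bar>\<phi> x\<bar> powr p)" using \<phi>_int by simp
    show "AE x in M. norm (k x y * \<bar>\<phi> x\<bar> powr p) \<le> norm (B * \<bar>\<phi> x\<bar> powr p)"
      using k_bounds[of _ y]
      by (intro AE_I2) (auto simp: abs_mult intro!: mult_right_mono intro: order_trans[OF _ abs_ge_self])
  qed (use that in measurable)
  have I_nonneg: "0 \<le> I y" for y
    unfolding I_def by (intro integral_nonneg_AE AE_I2 mult_nonneg_nonneg) (auto simp: k_bounds)
  have nn_I: "(\<integral>\<^sup>+x. ennreal (k x y * \<bar>\<phi> x\<bar> powr p) \<partial>M) = ennreal (I y)" if "y \<in> space N" for y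
    unfolding I_def
    by (rule nn_integral_eq_integral[OF I_int[OF that]]) (auto simp: k_bounds)
  have bound: "(\<integral>\<^sup>+x. ennreal (k x y * \<bar>\<phi> x\<bar>) \<partial>M) \<le> ennreal (I y powr (1 / p) * C powr (1 / q))"
    if y: "y \<in> space N" for y
  proof -
    note k1[OF y, measurable]
    have "(\<integral>\<^sup>+x. ennreal (k x y * \<bar>\<phi> x\<bar>) \<partial>M) =
        (\<integral>\<^sup>+x. ennreal ((k x y powr (1 / p) * \<bar>\<phi> x\<bar>) * k x y powr (1 / q)) \<partial>M)"
    proof (intro nn_integral_cong arg_cong[where f = ennreal])
      fix x
      have "k x y powr (1 / p) * k x y powr (1 / q) = k x y"
        using pq k_bounds[of x y] by (simp flip: powr_add)
      then show "k x y * \<bar>\<phi> x\<bar> = (k x y powr (1 / p) * \<bar>\<phi> x\<bar>) * k x y powr (1 / q)"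
        by (metis mult.assoc mult.commute)
    qed
    also have "\<dots> \<le> ennreal (I y powr (1 / p) * C powr (1 / q))"
    proof (rule holder_nn_integral)
      have "(\<integral>\<^sup>+x. ennreal ((k x y powr (1 / p) * \<bar>\<phi> x\<bar>) powr p) \<partial>M)
          = (\<integral>\<^sup>+x. ennreal (k x y * \<bar>\<phi> x\<bar> powr p) \<partial>M)"
        using pq k_bounds by (intro nn_integral_cong) (simp add: powr_mult powr_powr)
      then show "(\<integral>\<^sup>+x. ennreal ((k x y powr (1 / p) * \<bar>\<phi> x\<bar>) powr p) \<partial>M) \<le> ennreal (I y)"
        using nn_I[OF y] by simp
      have "(\<integral>\<^sup>+x. ennreal ((k x y powr (1 / q)) powr q) \<partial>M) = (\<integral>\<^sup>+x. ennreal (k x y) \<partial>M)"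
        using q k_bounds by (intro nn_integral_cong) (simp add: powr_powr)
      then show "(\<integral>\<^sup>+x. ennreal ((k x y powr (1 / q)) powr q) \<partial>M) \<le> ennreal C"
        using marg_M[OF y] by simp
    qed (use pq q \<open>0 \<le> C\<close> I_nonneg k_bounds in auto)
    finally show ?thesis .
  qed
  show A: "integrable M (\<lambda>x. k x y * \<phi> x)" if y: "y \<in> space N" for y
  proof (rule integrableI_bounded)
    note k1[OF y, measurable]
    show "(\<lambda>x. k x y * \<phi> x) \<in> borel_measurable M" by measurable
    have "(\<integral>\<^sup>+x. ennreal (norm (k x y * \<phi> x)) \<partial>M) = (\<integral>\<^sup>+x. ennreal (k x y * \<bar>\<phi> x\<bar>) \<partial>M)"
      using k_bounds by (simp add: abs_mult)
    also have "\<dots> < \<infinity>" using bound[OF y] by (simp add: le_less_trans)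
    finally show "(\<integral>\<^sup>+x. ennreal (norm (k x y * \<phi> x)) \<partial>M) < \<infinity>" .
  qed
  have powr_bound: "\<bar>\<integral>x. k x y * \<phi> x \<partial>M\<bar> powr p \<le> C powr (p - 1) * I y" if y: "y \<in> space N" for y
  proof -
    have "ennreal \<bar>\<integral>x. k x y * \<phi> x \<partial>M\<bar> \<le> (\<integral>\<^sup>+x. ennreal (k x y * \<bar>\<phi> x\<bar>) \<partial>M)"
      using integral_norm_bound_ennreal[OF A[OF y]] k_bounds by (simp add: abs_mult)
    also note bound[OF y]
    finally have "\<bar>\<integral>x. k x y * \<phi> x \<partial>M\<bar> \<le> I y powr (1 / p) * C powr (1 / q)" 
      by (subst (asm) ennreal_le_iff) auto
    then have "\<bar>\<integral>x. k x y * \<phi> x \<partial>M\<bar> powr p \<le> (I y powr (1 / p) * C powr (1 / q)) powr p"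
      using pq by (intro powr_mono2) auto
    also have "\<dots> = C powr (p - 1) * I y"
      using pq q I_nonneg[of y] \<open>0 \<le> C\<close> by (simp add: powr_mult powr_powr)
    finally show ?thesis .
  qed
  have meas [measurable]: "(\<lambda>y. \<integral>x. k x y * \<phi> x \<partial>M) \<in> borel_measurable N"
  proof -
    have "(\<lambda>(y, x). k x y * \<phi> x) \<in> borel_measurable (N \<Otimes>\<^sub>M M)"
      by measurable
    then show ?thesis by (rule M1.borel_measurable_lebesgue_integral)
  qed
  have total: "(\<integral>\<^sup>+y. ennreal (\<bar>\<integral>x. k x y * \<phi> x \<partial>M\<bar> powr p) \<partial>N)
      \<le> ennreal (C powr p * (\<integral>x. \<bar>\<phi> x\<bar> powr p \<partial>M))"
  proof -
    have "(\<integral>\<^sup>+y. ennreal (\<bar>\<integral>x. k x y * \<phi> x \<partial>M\<bar> powr p) \<partial>N)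
        \<le> (\<integral>\<^sup>+y. ennreal (C powr (p - 1)) * (\<integral>\<^sup>+x. ennreal (k x y * \<bar>\<phi> x\<bar> powr p) \<partial>M) \<partial>N)"
      using powr_bound by (intro nn_integral_mono) (simp add: nn_I I_nonneg flip: ennreal_mult)
    also have "\<dots> = ennreal (C powr (p - 1)) * (\<integral>\<^sup>+y. (\<integral>\<^sup>+x. ennreal (k x y * \<bar>\<phi> x\<bar> powr p) \<partial>M) \<partial>N)"
      by (rule nn_integral_cmult) measurable
    also have "(\<integral>\<^sup>+y. (\<integral>\<^sup>+x. ennreal (k x y * \<bar>\<phi> x\<bar> powr p) \<partial>M) \<partial>N)
        = (\<integral>\<^sup>+x. (\<integral>\<^sup>+y. ennreal (k x y * \<bar>\<phi> x\<bar> powr p) \<partial>N) \<partial>M)"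
      by (rule Fubini') measurable
    also have "\<dots> = (\<integral>\<^sup>+x. ennreal (\<bar>\<phi> x\<bar> powr p) * (\<integral>\<^sup>+y. ennreal (k x y) \<partial>N) \<partial>M)"
    proof (intro nn_integral_cong)
      fix x assume x: "x \<in> space M"
      have "(\<integral>\<^sup>+y. ennreal (k x y * \<bar>\<phi> x\<bar> powr p) \<partial>N) = (\<integral>\<^sup>+y. ennreal (\<bar>\<phi> x\<bar> powr p) * ennreal (k x y) \<partial>N)"
        using k_bounds by (intro nn_integral_cong) (simp add: mult.commute flip: ennreal_mult)
      also have "\<dots> = ennreal (\<bar>\<phi> x\<bar> powr p) * (\<integral>\<^sup>+y. ennreal (k x y) \<partial>N)"
        using x by (intro nn_integral_cmult) measurable
      finally show "(\<integral>\<^sup>+y. ennreal (k x y * \<bar>\<phi> x\<bar> powr p) \<partial>N) = \<dots>" .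
    qed
    also have "\<dots> \<le> (\<integral>\<^sup>+x. ennreal (\<bar>\<phi> x\<bar> powr p) * ennreal C \<partial>M)"
      by (intro nn_integral_mono mult_left_mono marg_N) auto
    also have "\<dots> = ennreal C * ennreal (\<integral>x. \<bar>\<phi> x\<bar> powr p \<partial>M)"
      by (subst nn_integral_multc) (simp_all add: nn_integral_eq_integral[OF \<phi>_int] mult.commute)
    also have "ennreal (C powr (p - 1)) * \<dots> = ennreal (C powr p * (\<integral>x. \<bar>\<phi> x\<bar> powr p \<partial>M))"
    proof -
      have "C powr (p - 1) * C = C powr p"
        using \<open>0 \<le> C\<close> pq powr_mult_base[of C "p - 1"] by (simp add: mult.commute)
      then show ?thesis using \<open>0 \<le> C\<close> by (simp add: ennreal_mult[symmetric] mult.assoc[symmetric])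
    qed
    finally show ?thesis by (simp add: mult_left_mono)
  qed
  show B: "integrable N (\<lambda>y. \<bar>\<integral>x. k x y * \<phi> x \<partial>M\<bar> powr p)"
    using total by (intro integrableI_bounded) (auto simp: le_less_trans)
  show "(\<integral>y. \<bar>\<integral>x. k x y * \<phi> x \<partial>M\<bar> powr p \<partial>N) \<le> C powr p * (\<integral>x. \<bar>\<phi> x\<bar> powr p \<partial>M)"
    using total unfolding nn_integral_eq_integral[OF B AE_I2[OF powr_ge_zero]]
    by (subst (asm) ennreal_le_iff) (auto intro!: mult_nonneg_nonneg integral_nonneg_AE)
qed

text \<open>
  The equality case of Hoelder's inequality: \<open>b = g^(p - 1)\<close> satisfies \<open>b^q = g^p = g b\<close>. Hence the
  pairing of \<open>g\<close> with \<open>b\<close> is \<open>\<integral> g^p\<close>, and moving the kernel to \<open>b\<close> shows that the transposed operator stretches \<open>b\<close> at least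
  as much as the operator itself stretches \<open>\<phi>\<close>. So one family of test functions serves both operators.
\<close>
lemma dual_extremal:
  fixes k :: "'a \<Rightarrow> 'b \<Rightarrow> real" and \<phi> :: "'a \<Rightarrow> real"
  assumes pair: "pair_sigma_finite M N"
    and pq: "1 < p" "1 / p + 1 / q = 1"
    and k_meas: "case_prod k \<in> borel_measurable (M \<Otimes>\<^sub>M N)"
    and k_bounds: "\<And>x y. 0 \<le> k x y" "\<And>x y. k x y \<le> B"
    and "0 \<le> C"
    and marg_M: "\<And>y. y \<in> space N \<Longrightarrow> (\<integral>\<^sup>+x. ennreal (k x y) \<partial>M) \<le> ennreal C"
    and marg_N: "\<And>x. x \<in> space M \<Longrightarrow> (\<integral>\<^sup>+y. ennreal (k x y) \<partial>N) \<le> ennreal C"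
    and \<phi>_meas [measurable]: "\<phi> \<in> borel_measurable M"
    and \<phi>_nonneg: "\<And>x. 0 \<le> \<phi> x"
    and \<phi>_int: "integrable M (\<lambda>x. \<phi> x powr p)"
  defines "g \<equiv> \<lambda>y. \<integral>x. k x y * \<phi> x \<partial>M"
  defines "b \<equiv> \<lambda>y. g y powr (p - 1)"
  shows "b \<in> borel_measurable N"
    and "integrable N (\<lambda>y. \<bar>b y\<bar> powr q)"
    and "(\<integral>y. \<bar>b y\<bar> powr q \<partial>N) = (\<integral>y. g y powr p \<partial>N)"
    and "(\<integral>y. g y powr p \<partial>N) \<le> (\<integral>x. \<phi> x powr p \<partial>M) powr (1 / p)
           * (\<integral>x. \<bar>\<integral>y. k x y * b y \<partial>N\<bar> powr q \<partial>M) powr (1 / q)"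
proof -
  interpret pair_sigma_finite M N by fact
  note k_meas [measurable]
  note q = conjugate_exponent[OF pq]
  have qp: "1 < q" "1 / q + 1 / p = 1" using q pq by auto
  have \<phi>_abs: "integrable M (\<lambda>x. \<bar>\<phi> x\<bar> powr p)" using \<phi>_int \<phi>_nonneg by simp
  note S = schur_test[OF pair pq k_meas k_bounds \<open>0 \<le> C\<close> marg_M marg_N \<phi>_meas \<phi>_abs]
  have S1: "integrable M (\<lambda>x. k x y * \<phi> x)" if "y \<in> space N" for y
    by (rule S(1)) (use that in auto)
  have g_nonneg: "0 \<le> g y" for y
    unfolding g_def by (intro integral_nonneg_AE AE_I2 mult_nonneg_nonneg k_bounds \<phi>_nonneg)
  have g_meas [measurable]: "g \<in> borel_measurable N"
  proof -
    have "(\<lambda>(y, x). k x y * \<phi> x) \<in> borel_measurable (N \<Otimes>\<^sub>M M)"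
      by measurable
    then show ?thesis unfolding g_def by (rule M1.borel_measurable_lebesgue_integral)
  qed
  show b_meas [measurable]: "b \<in> borel_measurable N" unfolding b_def by measurable
  have b_nonneg: "0 \<le> b y" for y by (simp add: b_def)
  have bq: "\<bar>b y\<bar> powr q = g y powr p" for y
    using q by (simp add: b_def powr_powr)
  have g_int: "integrable N (\<lambda>y. g y powr p)"
    using S(2) g_nonneg by (simp add: g_def)
  show b_int: "integrable N (\<lambda>y. \<bar>b y\<bar> powr q)" using g_int by (simp add: bq)
  show "(\<integral>y. \<bar>b y\<bar> powr q \<partial>N) = (\<integral>y. g y powr p \<partial>N)" by (simp add: bq)
  have pair': "pair_sigma_finite N M" by (simp add: pair_sigma_finite.intro M1.sigma_finite_measure_axioms M2.sigma_finite_measure_axioms)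
  have k_meas': "case_prod (\<lambda>y x. k x y) \<in> borel_measurable (N \<Otimes>\<^sub>M M)" by measurable
  note S' = schur_test[OF pair' qp k_meas' k_bounds \<open>0 \<le> C\<close> marg_N marg_M b_meas b_int]
  have S1': "integrable N (\<lambda>y. k x y * b y)" if "x \<in> space M" for x
    by (rule S'(1)) (use that in auto)
  define h where "h x = (\<integral>y. k x y * b y \<partial>N)" for x
  have h_nonneg: "0 \<le> h x" for x
    unfolding h_def by (intro integral_nonneg_AE AE_I2 mult_nonneg_nonneg k_bounds b_nonneg)
  have h_meas [measurable]: "h \<in> borel_measurable M"
  proof -
    have "(\<lambda>(x, y). k x y * b y) \<in> borel_measurable (M \<Otimes>\<^sub>M N)"
      by measurable
    then show ?thesis unfolding h_def by (rule M2.borel_measurable_lebesgue_integral)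
  qed
  have h_int: "integrable M (\<lambda>x. h x powr q)" using S'(2) h_nonneg by (simp add: h_def)
  have "ennreal (\<integral>y. g y powr p \<partial>N) = (\<integral>\<^sup>+y. ennreal (g y powr p) \<partial>N)"
    by (rule nn_integral_eq_integral[symmetric, OF g_int]) auto
  also have "\<dots> = (\<integral>\<^sup>+y. (\<integral>\<^sup>+x. ennreal (k x y * \<phi> x * b y) \<partial>M) \<partial>N)"
  proof (rule nn_integral_cong)
    fix y assume y: "y \<in> space N"
    have "(\<integral>\<^sup>+x. ennreal (k x y * \<phi> x * b y) \<partial>M) = ennreal (\<integral>x. k x y * \<phi> x * b y \<partial>M)"
      using S1[OF y] by (intro nn_integral_eq_integral) (auto simp: k_bounds \<phi>_nonneg b_nonneg)
    also have "(\<integral>x. k x y * \<phi> x * b y \<partial>M) = g y * b y" by (simp add: g_def)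
    also have "\<dots> = g y powr p"
      using powr_mult_base[of "g y" "p - 1"] g_nonneg[of y] pq by (simp add: b_def)
    finally show "ennreal (g y powr p) = (\<integral>\<^sup>+x. ennreal (k x y * \<phi> x * b y) \<partial>M)" ..
  qed
  also have "\<dots> = (\<integral>\<^sup>+x. (\<integral>\<^sup>+y. ennreal (k x y * \<phi> x * b y) \<partial>N) \<partial>M)"
    by (rule Fubini') measurable
  also have "\<dots> = (\<integral>\<^sup>+x. ennreal (\<phi> x * h x) \<partial>M)"
  proof (rule nn_integral_cong)
    fix x assume x: "x \<in> space M"
    have "(\<integral>\<^sup>+y. ennreal (k x y * \<phi> x * b y) \<partial>N) = (\<integral>\<^sup>+y. ennreal (\<phi> x * (k x y * b y)) \<partial>N)"
      by (simp add: ac_simps)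
    also have "\<dots> = ennreal (\<integral>y. \<phi> x * (k x y * b y) \<partial>N)"
      using S1'[OF x] by (intro nn_integral_eq_integral) (auto simp: k_bounds \<phi>_nonneg b_nonneg)
    finally show "(\<integral>\<^sup>+y. ennreal (k x y * \<phi> x * b y) \<partial>N) = ennreal (\<phi> x * h x)"
      by (simp add: h_def)
  qed
  also have "\<dots> \<le> ennreal ((\<integral>x. \<phi> x powr p \<partial>M) powr (1 / p) * (\<integral>x. h x powr q \<partial>M) powr (1 / q))"
  proof (rule holder_nn_integral[OF pq(1) qp(1) pq(2)])
    show "(\<integral>\<^sup>+x. ennreal (\<phi> x powr p) \<partial>M) \<le> ennreal (\<integral>x. \<phi> x powr p \<partial>M)"
      using nn_integral_eq_integral[OF \<phi>_int] by simp
    show "(\<integral>\<^sup>+x. ennreal (h x powr q) \<partial>M) \<le> ennreal (\<integral>x. h x powr q \<partial>M)"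
      using nn_integral_eq_integral[OF h_int] by simp
  qed (auto simp: \<phi>_nonneg h_nonneg intro!: integral_nonneg_AE)
  finally show "(\<integral>y. g y powr p \<partial>N) \<le> (\<integral>x. \<phi> x powr p \<partial>M) powr (1 / p)
           * (\<integral>x. \<bar>\<integral>y. k x y * b y \<partial>N\<bar> powr q \<partial>M) powr (1 / q)"
    using h_nonneg by (simp add: h_def)
qed

section \<open>Logarithmic coordinates\<close>

text \<open>
  The substitution \<open>s = ln (u x)\<close>, with \<open>u\<close> increasing from \<open>0\<close> to \<open>\<infinity>\<close>. On compact intervals it is
  classical; the measures with the two integrands as densities then agree on exhausting sequences.
\<close>
lemma nn_integral_log_substitution:
  fixes u m F :: "real \<Rightarrow> real"
  assumes der: "\<And>x. 0 < x \<Longrightarrow> (u has_real_derivative m x) (at x)"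
    and u_pos: "\<And>x. 0 < x \<Longrightarrow> 0 < u x"
    and m_pos: "\<And>x. 0 < x \<Longrightarrow> 0 < m x"
    and m_cont: "continuous_on {0<..} m"
    and u_0: "(\<lambda>n. u (1 / real (Suc n))) \<longlonglongrightarrow> 0"
    and u_top: "filterlim (\<lambda>n. u (real (Suc n))) at_top sequentially"
    and F [measurable]: "F \<in> borel_measurable borel"
  shows "(\<integral>\<^sup>+x. ennreal (F (ln (u x)) * (m x / u x)) * indicator {0<..} x \<partial>lborel) = (\<integral>\<^sup>+s. ennreal (F s) \<partial>lborel)"
proof -
  define I where "I n = {1 / real (Suc n)..real (Suc n)}" for n
  define J where "J n = {ln (u (1 / real (Suc n)))..ln (u (real (Suc n)))}" for n
  define G where "G x = ennreal (F (ln (u x)) * (m x / u x)) * indicator {0<..} x" for x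
  have u_cont: "continuous_on {0<..} u"
    by (intro continuous_at_imp_continuous_on) (auto intro: DERIV_isCont der)
  have G_meas [measurable]: "G \<in> borel_measurable borel"
  proof -
    have 1: "(\<lambda>x. indicator {0<..} x *\<^sub>R u x) \<in> borel_measurable borel"
      using u_cont by (intro borel_measurable_continuous_on_indicator) auto
    have 2: "(\<lambda>x. indicator {0<..} x *\<^sub>R m x) \<in> borel_measurable borel"
      using m_cont by (intro borel_measurable_continuous_on_indicator) auto
    have "G = (\<lambda>x. ennreal (F (ln (indicator {0<..} x *\<^sub>R u x)) * ((indicator {0<..} x *\<^sub>R m x) / (indicator {0<..} x *\<^sub>R u x))) * indicator {0<..} x)"
      by (auto simp: G_def fun_eq_iff split: split_indicator)
    also have "\<dots> \<in> borel_measurable borel"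
      using 1 2 by measurable
    finally show ?thesis .
  qed
  have I_pos: "0 < x" if "x \<in> I n" for x n
    using that unfolding I_def by (auto intro: less_le_trans[rotated])
  have eq: "(\<integral>\<^sup>+s. ennreal (F s) * indicator (J n) s \<partial>lborel) = (\<integral>\<^sup>+x. G x * indicator (I n) x \<partial>lborel)" for n
  proof -
    have "(\<integral>\<^sup>+s. ennreal (F s * indicator (J n) s) \<partial>lborel)
        = (\<integral>\<^sup>+x. ennreal (F (ln (u x)) * (m x / u x) * indicator (I n) x) \<partial>lborel)"
      unfolding J_def I_def
    proof (rule nn_integral_substitution[where f = F and g = "\<lambda>x. ln (u x)" and g' = "\<lambda>x. m x / u x"])
      show "set_borel_measurable borel {ln (u (1 / real (Suc n)))..ln (u (real (Suc n)))} F"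
        unfolding set_borel_measurable_def by measurable
      fix x assume "x \<in> {1 / real (Suc n)..real (Suc n)}"
      then have x: "0 < x" using I_pos[of x n] by (simp add: I_def)
      show "((\<lambda>x. ln (u x)) has_real_derivative m x / u x) (at x)"
        using der[OF x] u_pos[OF x] by (auto intro!: derivative_eq_intros simp: divide_inverse)
      show "0 \<le> m x / u x" using m_pos[OF x] u_pos[OF x] by simp
    next
      have *: "{1 / real (Suc n)..real (Suc n)} \<subseteq> {0<..}" using I_pos unfolding I_def by blast
      show "continuous_on {1 / real (Suc n)..real (Suc n)} (\<lambda>x. m x / u x)"
        using continuous_on_subset[OF m_cont *] continuous_on_subset[OF u_cont *] * u_pos
        by (intro continuous_on_divide) force+
      have "1 / real (Suc n) \<le> 1" "1 \<le> real (Suc n)" by simp_all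
      then show "1 / real (Suc n) \<le> real (Suc n)" by linarith
    qed
    also have "\<dots> = (\<integral>\<^sup>+x. G x * indicator (I n) x \<partial>lborel)"
      using I_pos by (intro nn_integral_cong) (auto simp: G_def split: split_indicator)
    finally show ?thesis by (simp add: nn_integral_set_ennreal)
  qed
  have incI: "incseq I"
    unfolding I_def by (intro incseq_SucI) (auto intro: order_trans[rotated] simp: field_simps)
  have u_mono: "u x \<le> u y" if "0 < x" "x \<le> y" for x y
  proof (rule DERIV_nonneg_imp_nondecreasing[OF that(2)])
    fix t assume "x \<le> t"
    then have "0 < t" using that by simp
    then show "\<exists>d. (u has_real_derivative d) (at t) \<and> 0 \<le> d"
      using der m_pos less_imp_le by blast
  qed
  have incJ: "incseq J"
  proof (intro incseq_SucI)
    fix n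
    have "ln (u (1 / real (Suc (Suc n)))) \<le> ln (u (1 / real (Suc n)))"
      "ln (u (real (Suc n))) \<le> ln (u (real (Suc (Suc n))))"
      by (intro ln_mono u_pos u_mono; simp add: field_simps)+
    then show "J n \<le> J (Suc n)" unfolding J_def by auto
  qed
  have UI: "(\<Union>n. I n) = {0<..}"
  proof (intro equalityI subsetI)
    fix x :: real assume "x \<in> {0<..}"
    then have x: "0 < x" by simp
    obtain n1 where n1: "x < real n1" using reals_Archimedean2 by blast
    obtain n2 where n2: "1 / x < real n2" using reals_Archimedean2 by blast
    have "1 < x * real n2" using n2 x by (simp add: field_simps)
    also have "x * real n2 \<le> x * real (Suc (max n1 n2))"
      using x by (intro mult_left_mono) auto
    finally have "x \<in> I (max n1 n2)"
      using n1 x unfolding I_def atLeastAtMost_iff by (subst divide_le_eq) auto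
    then show "x \<in> (\<Union>n. I n)" by blast
  qed (use I_pos in auto)
  have UJ: "(\<Union>n. J n) = UNIV"
  proof (intro equalityI subsetI UNIV_I)
    fix s :: real
    have "eventually (\<lambda>n. u (1 / real (Suc n)) < exp s) sequentially"
      using order_tendstoD(2)[OF u_0, of "exp s"] by simp
    moreover have "eventually (\<lambda>n. exp s < u (real (Suc n))) sequentially"
      using u_top unfolding filterlim_at_top_dense by (rule spec)
    ultimately have "eventually (\<lambda>n. u (1 / real (Suc n)) < exp s \<and> exp s < u (real (Suc n))) sequentially"
      by eventually_elim simp
    then obtain n where n: "u (1 / real (Suc n)) < exp s" "exp s < u (real (Suc n))"
      by (auto simp: eventually_sequentially)
    have "ln (u (1 / real (Suc n))) < ln (exp s)" "ln (exp s) < ln (u (real (Suc n)))"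
      by (intro ln_less_cancel_iff[THEN iffD2] n u_pos exp_gt_zero; simp)+
    then have "s \<in> J n" unfolding J_def by simp
    then show "s \<in> (\<Union>n. J n)" by blast
  qed
  have lim1: "(\<lambda>n. emeasure (density lborel G) (I n)) \<longlonglongrightarrow> emeasure (density lborel G) (\<Union>n. I n)"
    by (intro Lim_emeasure_incseq incI) (auto simp: I_def)
  have lim2: "(\<lambda>n. emeasure (density lborel (\<lambda>s. ennreal (F s))) (J n)) \<longlonglongrightarrow> emeasure (density lborel (\<lambda>s. ennreal (F s))) (\<Union>n. J n)"
    by (intro Lim_emeasure_incseq incJ) (auto simp: J_def)
  have eq': "emeasure (density lborel G) (I n) = emeasure (density lborel (\<lambda>s. ennreal (F s))) (J n)" for n
    using eq[of n] by (subst (1 2) emeasure_density) (auto simp: I_def J_def)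
  have "emeasure (density lborel G) (\<Union>n. I n) = emeasure (density lborel (\<lambda>s. ennreal (F s))) (\<Union>n. J n)"
    by (rule LIMSEQ_unique[OF lim1[unfolded eq'] lim2])
  then have "(\<integral>\<^sup>+x. G x * indicator {0<..} x \<partial>lborel) = (\<integral>\<^sup>+s. ennreal (F s) \<partial>lborel)"
    unfolding UI UJ by (subst (asm) (1 2) emeasure_density) auto
  moreover have "G x * indicator {0<..} x = G x" for x by (simp add: G_def split: split_indicator)
  ultimately show ?thesis unfolding G_def by simp
qed

lemma nn_integral_log_coordinate:
  fixes F :: "real \<Rightarrow> real"
  assumes [measurable]: "F \<in> borel_measurable borel"
  shows "(\<integral>\<^sup>+t. ennreal (F (ln t) / t) * indicator {0<..} t \<partial>lborel) = (\<integral>\<^sup>+s. ennreal (F s) \<partial>lborel)"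
proof -
  have "filterlim (\<lambda>n. real (Suc n)) at_top sequentially"
    by (rule filterlim_compose[OF filterlim_real_sequentially filterlim_Suc])
  then show ?thesis
    using nn_integral_log_substitution[of "\<lambda>x. x" "\<lambda>_. 1" F] LIMSEQ_inverse_real_of_nat
    by (simp add: inverse_eq_divide)
qed

lemma
  fixes \<mu> :: "real \<Rightarrow> real"
  assumes mu_pos: "\<And>x. 0 < x \<Longrightarrow> 0 < \<mu> x"
    and mu_cont: "continuous_on {0<..} \<mu>"
    and U_finite: "\<And>x. 0 \<le> x \<Longrightarrow> set_integrable lborel {0<..x} \<mu>"
    and U_inf: "U_infinity \<mu> = \<infinity>"
  shows U_fun_pos: "\<And>x. 0 < x \<Longrightarrow> 0 < U_fun \<mu> x"
    and U_fun_deriv: "\<And>x. 0 < x \<Longrightarrow> (U_fun \<mu> has_real_derivative \<mu> x) (at x)"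
    and U_fun_tendsto_0: "(\<lambda>n. U_fun \<mu> (1 / real (Suc n))) \<longlonglongrightarrow> 0"
    and U_fun_at_top: "filterlim (\<lambda>n. U_fun \<mu> (real (Suc n))) at_top sequentially"
proof -
  have [measurable]: "(\<lambda>t. ennreal (\<mu> t) * indicator {0<..} t) \<in> borel_measurable borel"
  proof -
    have [measurable]: "(\<lambda>x. indicator {0<..} x *\<^sub>R \<mu> x) \<in> borel_measurable borel"
      using mu_cont by (intro borel_measurable_continuous_on_indicator) auto
    have "(\<lambda>t. ennreal (\<mu> t) * indicator {0<..} t) = (\<lambda>t. ennreal (indicator {0<..} t *\<^sub>R \<mu> t))"
      by (auto simp: fun_eq_iff split: split_indicator)
    also have "\<dots> \<in> borel_measurable borel" by measurable
    finally show ?thesis .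
  qed
  define D where "D = density lborel (\<lambda>t. ennreal (\<mu> t) * indicator {0<..} t)"
  have sets_D [simp]: "sets D = sets borel" by (simp add: D_def)
  have D_eq: "emeasure D {0<..x} = ennreal (U_fun \<mu> x)" if "0 \<le> x" for x
  proof -
    have "emeasure D {0<..x} = (\<integral>\<^sup>+t. ennreal (indicator {0<..x} t *\<^sub>R \<mu> t) \<partial>lborel)"
      unfolding D_def by (subst emeasure_density) (auto intro!: nn_integral_cong split: split_indicator)
    also have "\<dots> = ennreal (\<integral>t. indicator {0<..x} t *\<^sub>R \<mu> t \<partial>lborel)"
      using U_finite[OF that] unfolding set_integrable_def
      by (rule nn_integral_eq_integral) (auto intro!: AE_I2 less_imp_le[OF mu_pos] split: split_indicator)
    finally show ?thesis by (simp add: U_fun_def set_lebesgue_integral_def)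
  qed
  have U_nonneg: "0 \<le> U_fun \<mu> x" for x
    unfolding U_fun_def set_lebesgue_integral_def
    by (rule integral_nonneg_AE) (auto intro!: AE_I2 less_imp_le[OF mu_pos] split: split_indicator)
  have split: "U_fun \<mu> y = U_fun \<mu> a + integral {a..y} \<mu>" if "0 < a" "a \<le> y" for a y
  proof -
    have *: "set_integrable lborel {a<..y} \<mu>" "set_integrable lborel {0<..a} \<mu>"
      using U_finite[of y] that by (auto intro: set_integrable_subset)
    have "{0<..y} = {0<..a} \<union> {a<..y}" using that by auto
    then have "U_fun \<mu> y = U_fun \<mu> a + (LBINT t:{a<..y}. \<mu> t)"
      unfolding U_fun_def using * by (simp add: set_integral_Un)
    also have "(LBINT t:{a<..y}. \<mu> t) = integral {a<..y} \<mu>"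
      using * by (intro set_borel_integral_eq_integral)
    also have "\<dots> = integral {a..y} \<mu>"
      by (rule integral_subset_negligible) (auto intro: negligible_subset[of "{a}"])
    finally show ?thesis .
  qed
  show deriv: "(U_fun \<mu> has_real_derivative \<mu> x) (at x)" if x: "0 < x" for x
  proof -
    have "continuous_on {x/2..2*x} \<mu>"
      using x by (intro continuous_on_subset[OF mu_cont]) auto
    then have "((\<lambda>y. integral {x/2..y} \<mu>) has_real_derivative \<mu> x) (at x within {x/2..2*x})"
      using x by (intro integral_has_real_derivative) auto
    then have "((\<lambda>y. integral {x/2..y} \<mu>) has_real_derivative \<mu> x) (at x within {x/2<..<2*x})"
      by (rule DERIV_subset) auto
    then have "((\<lambda>y. integral {x/2..y} \<mu>) has_real_derivative \<mu> x) (at x)"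
      using x by (subst (asm) at_within_open) auto
    then have h: "((\<lambda>y. U_fun \<mu> (x/2) + integral {x/2..y} \<mu>) has_real_derivative \<mu> x) (at x)"
      by (auto intro!: derivative_eq_intros)
    moreover have "U_fun \<mu> (x/2) + integral {x/2..y} \<mu> = U_fun \<mu> y" if "y \<in> {x/2<..<2*x}" for y
      using split[of "x/2" y] x that by simp
    ultimately show ?thesis
      using x by (intro has_field_derivative_transform_within_open[OF h, where S = "{x/2<..<2*x}"]) auto
  qed
  show pos: "0 < U_fun \<mu> x" if x: "0 < x" for x
  proof -
    have "U_fun \<mu> (x/2) < U_fun \<mu> x"
    proof (rule DERIV_pos_imp_increasing[where f = "U_fun \<mu>" and a = "x/2" and b = x])
      fix t assume "x/2 \<le> t" "t \<le> x"
      then show "\<exists>y. (U_fun \<mu> has_real_derivative y) (at t) \<and> 0 < y"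
        using x deriv[of t] mu_pos[of t] by (intro exI[of _ "\<mu> t"]) auto
    qed (use x in auto)
    then show ?thesis using U_nonneg[of "x/2"] by linarith
  qed
  show "(\<lambda>n. U_fun \<mu> (1 / real (Suc n))) \<longlonglongrightarrow> 0"
  proof -
    have "(\<lambda>n. emeasure D {0<..1 / real (Suc n)}) \<longlonglongrightarrow> emeasure D (\<Inter>n. {0<..1 / real (Suc n)})"
    proof (rule Lim_emeasure_decseq)
      show "decseq (\<lambda>n. {0<..1 / real (Suc n)})"
        unfolding decseq_Suc_iff by (auto intro: order_trans simp: field_simps)
      show "emeasure D {0<..1 / real (Suc i)} \<noteq> \<infinity>" for i by (subst D_eq) auto
    qed auto
    moreover have "(\<Inter>n. {0<..1 / real (Suc n)}) = {}"
    proof -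
      have "\<exists>n. x \<notin> {0<..1 / real (Suc n)}" for x :: real
      proof (cases "0 < x")
        case True
        then obtain n where "inverse (real (Suc n)) < x" using reals_Archimedean by blast
        then have "x \<notin> {0<..1 / real (Suc n)}" by (simp add: inverse_eq_divide)
        then show ?thesis ..
      qed auto
      then show ?thesis by blast
    qed
    ultimately have "(\<lambda>n. ennreal (U_fun \<mu> (1 / real (Suc n)))) \<longlonglongrightarrow> ennreal 0"
      by (simp add: D_eq)
    then show ?thesis by (subst (asm) tendsto_ennreal_iff) (auto simp: U_nonneg)
  qed
  show "filterlim (\<lambda>n. U_fun \<mu> (real (Suc n))) at_top sequentially"
  proof -
    have "(\<lambda>n. emeasure D {0<..real (Suc n)}) \<longlonglongrightarrow> emeasure D (\<Union>n. {0<..real (Suc n)})"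
      by (rule Lim_emeasure_incseq) (auto simp: incseq_Suc_iff)
    moreover have "(\<Union>n. {0<..real (Suc n)}) = {0<..}"
    proof (intro equalityI subsetI)
      fix x :: real assume "x \<in> {0<..}"
      moreover obtain n where "x < real n" using reals_Archimedean2 by blast
      ultimately have "x \<in> {0<..real (Suc n)}" by simp
      then show "x \<in> (\<Union>n. {0<..real (Suc n)})" by blast
    qed auto
    moreover have "emeasure D {0<..} = \<infinity>"
    proof -
      have "emeasure D {0<..} = U_infinity \<mu>"
        unfolding D_def U_infinity_def
        by (subst emeasure_density) (auto intro!: nn_integral_cong split: split_indicator)
      then show ?thesis using U_inf by simp
    qed
    ultimately have "(\<lambda>n. ennreal (U_fun \<mu> (real (Suc n)))) \<longlonglongrightarrow> \<infinity>"
      by (simp add: D_eq)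
    then show ?thesis by (simp add: ennreal_tendsto_top_eq_at_top)
  qed
qed

text \<open>
  The sign \<open>\<delta>\<close> costs nothing in this coordinate, since Lebesgue measure on the line is invariant under reflection.
\<close>
lemma distr_log_primitive:
  fixes u m :: "real \<Rightarrow> real" and \<delta> :: real
  assumes der: "\<And>x. 0 < x \<Longrightarrow> (u has_real_derivative m x) (at x)"
    and u_pos: "\<And>x. 0 < x \<Longrightarrow> 0 < u x"
    and m_pos: "\<And>x. 0 < x \<Longrightarrow> 0 < m x"
    and m_cont: "continuous_on {0<..} m"
    and u_0: "(\<lambda>n. u (1 / real (Suc n))) \<longlonglongrightarrow> 0"
    and u_top: "filterlim (\<lambda>n. u (real (Suc n))) at_top sequentially"
    and \<delta>: "\<delta> \<in> {-1, 1}"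
  defines "M \<equiv> density (lebesgue_on {0<..}) (\<lambda>x. ennreal (m x / u x))"
  shows "(\<lambda>x. \<delta> * ln (u x)) \<in> borel_measurable M"
    and "distr M borel (\<lambda>x. \<delta> * ln (u x)) = lborel"
    and "(\<lambda>x. m x / u x) \<in> borel_measurable (lebesgue_on {0<..})"
proof -
  have u_cont: "continuous_on {0<..} u"
    by (intro continuous_at_imp_continuous_on) (auto intro: DERIV_isCont der)
  have u_ne: "u x \<noteq> 0" if "0 < x" for x using u_pos[OF that] by simp
  have [measurable]: "(\<lambda>x. \<delta> * ln (u x)) \<in> borel_measurable (lebesgue_on {0<..})"
    by (intro continuous_imp_measurable_on_sets_lebesgue continuous_intros u_cont) (auto simp: u_ne)
  show quot [measurable]: "(\<lambda>x. m x / u x) \<in> borel_measurable (lebesgue_on {0<..})"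
    by (intro continuous_imp_measurable_on_sets_lebesgue continuous_intros m_cont u_cont) (auto simp: u_ne)
  show meas [measurable]: "(\<lambda>x. \<delta> * ln (u x)) \<in> borel_measurable M"
    by (simp add: M_def)
  show "distr M borel (\<lambda>x. \<delta> * ln (u x)) = lborel"
  proof (rule measure_eqI)
    fix A assume "A \<in> sets (distr M borel (\<lambda>x. \<delta> * ln (u x)))"
    then have A [measurable]: "A \<in> sets borel" by simp
    have [measurable]: "(\<lambda>x. indicator A (\<delta> * ln (u x)) :: ennreal) \<in> borel_measurable (lebesgue_on {0<..})"
      by measurable
    have "emeasure (distr M borel (\<lambda>x. \<delta> * ln (u x))) A = (\<integral>\<^sup>+x. indicator A (\<delta> * ln (u x)) \<partial>M)"
      by (subst nn_integral_indicator[symmetric], simp, subst nn_integral_distr) auto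
    also have "\<dots> = (\<integral>\<^sup>+x. ennreal (m x / u x) * indicator A (\<delta> * ln (u x)) \<partial>lebesgue_on {0<..})"
      unfolding M_def by (rule nn_integral_density) measurable
    also have "\<dots> = (\<integral>\<^sup>+x. ennreal (m x / u x) * indicator A (\<delta> * ln (u x)) * indicator {0<..} x \<partial>lborel)"
      by (subst nn_integral_restrict_space) (auto simp: nn_integral_completion)
    also have "\<dots> = (\<integral>\<^sup>+x. ennreal (indicator A (\<delta> * ln (u x)) * (m x / u x)) * indicator {0<..} x \<partial>lborel)"
      by (intro nn_integral_cong) (auto split: split_indicator)
    also have "\<dots> = (\<integral>\<^sup>+s. ennreal (indicator A (\<delta> * s)) \<partial>lborel)"
      by (rule nn_integral_log_substitution[where F = "\<lambda>s. indicator A (\<delta> * s)"])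
         (use assms in \<open>auto simp del: of_nat_Suc\<close>)
    also have "\<dots> = (\<integral>\<^sup>+s. indicator A s \<partial>lborel)"
      using nn_integral_real_affine[of "indicator A" \<delta> 0] \<delta> by (auto simp: ennreal_indicator)
    also have "\<dots> = emeasure lborel A" by simp
    finally show "emeasure (distr M borel (\<lambda>x. \<delta> * ln (u x))) A = emeasure lborel A" .
  qed simp
qed

section \<open>The kernel and its Mellin constant\<close>

definition kern :: "real \<Rightarrow> real \<Rightarrow> real \<Rightarrow> real \<Rightarrow> real" where
  "kern \<alpha> \<rho> \<gamma> t = csch (\<rho> * t powr \<gamma>) / exp (\<alpha> * t powr \<gamma>)"

text \<open>The Mellin integrand \<open>K(t) t^\<sigma>\<close> with respect to \<open>dt/t\<close>, in the coordinate \<open>t = e^s\<close>.\<close>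
definition log_kern :: "real \<Rightarrow> real \<Rightarrow> real \<Rightarrow> real \<Rightarrow> real \<Rightarrow> real" where
  "log_kern \<alpha> \<rho> \<gamma> \<sigma> s = kern \<alpha> \<rho> \<gamma> (exp s) * exp (\<sigma> * s)"

text \<open>The geometric series \<open>csch u = 2 e^(-u) (1 + e^(-2u) + e^(-4u) + \<dots>)\<close>.\<close>
lemma kern_sums:
  assumes "0 < \<rho>" "0 < t"
  shows "(\<lambda>j. 2 * exp (- (\<alpha> + \<rho> * (2 * real j + 1)) * t powr \<gamma>)) sums kern \<alpha> \<rho> \<gamma> t"
proof -
  define w where "w = t powr \<gamma>"
  define u where "u = \<rho> * w"
  have u: "0 < u" using assms by (simp add: u_def w_def)
  have "norm (exp (- (2 * u))) < 1" using u by simp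
  then have "(\<lambda>j. exp (- (2 * u)) ^ j) sums (1 / (1 - exp (- (2 * u))))"
    by (rule geometric_sums)
  then have "(\<lambda>j. (2 * exp (- u) / exp (\<alpha> * w)) * exp (- (2 * u)) ^ j) sums
      ((2 * exp (- u) / exp (\<alpha> * w)) * (1 / (1 - exp (- (2 * u)))))"
    by (rule sums_mult)
  moreover have "(2 * exp (- u) / exp (\<alpha> * w)) * exp (- (2 * u)) ^ j
      = 2 * exp (- (\<alpha> + \<rho> * (2 * real j + 1)) * t powr \<gamma>)" for j
    by (simp add: u_def w_def[symmetric] exp_of_nat_mult[symmetric] exp_minus[symmetric] exp_add[symmetric] divide_inverse algebra_simps)
  moreover have "(2 * exp (- u) / exp (\<alpha> * w)) * (1 / (1 - exp (- (2 * u)))) = kern \<alpha> \<rho> \<gamma> t"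
  proof -
    have 1: "exp u - exp (- u) = exp u * (1 - exp (- (2 * u)))"
      by (simp add: algebra_simps flip: exp_add)
    have 2: "exp (- (2 * u)) \<noteq> 1" using u by simp
    show ?thesis
      unfolding kern_def csch_def w_def[symmetric] u_def[symmetric] 1
      using 2 by (simp add: exp_minus field_simps)
  qed
  ultimately show ?thesis by (simp only:)
qed

lemma kern_nonneg: "0 < \<rho> \<Longrightarrow> 0 \<le> kern \<alpha> \<rho> \<gamma> t"
  by (simp add: kern_def csch_def)

lemma log_kern_nonneg: "0 < \<rho> \<Longrightarrow> 0 \<le> log_kern \<alpha> \<rho> \<gamma> \<sigma> s"
  by (simp add: log_kern_def kern_nonneg)

lemma log_kern_measurable [measurable]: "log_kern \<alpha> \<rho> \<gamma> \<sigma> \<in> borel_measurable borel"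
  unfolding log_kern_def kern_def csch_def by measurable

lemma log_kern_sums:
  assumes "0 < \<rho>"
  shows "(\<lambda>j. 2 * exp (\<sigma> * s - (\<alpha> + \<rho> * (2 * real j + 1)) * exp (\<gamma> * s))) sums log_kern \<alpha> \<rho> \<gamma> \<sigma> s"
proof -
  have "(\<lambda>j. 2 * exp (- (\<alpha> + \<rho> * (2 * real j + 1)) * exp s powr \<gamma>) * exp (\<sigma> * s)) sums log_kern \<alpha> \<rho> \<gamma> \<sigma> s"
    unfolding log_kern_def by (intro sums_mult2 kern_sums assms) auto
  moreover have "2 * exp (- (\<alpha> + \<rho> * (2 * real j + 1)) * exp s powr \<gamma>) * exp (\<sigma> * s)
      = 2 * exp (\<sigma> * s - (\<alpha> + \<rho> * (2 * real j + 1)) * exp (\<gamma> * s))" for j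
    by (simp add: exp_powr_real mult_exp_exp mult.commute[of s] algebra_simps)
  ultimately show ?thesis by (simp only:)
qed

text \<open>Euler's integral for \<open>\<Gamma>(\<sigma>/\<gamma>)\<close> in logarithmic coordinates: the affine change \<open>u = ln c + \<gamma> s\<close>
  absorbs both \<open>c\<close> and \<open>\<gamma>\<close>.\<close>
lemma nn_integral_Gamma_log:
  assumes "0 < c" "0 < \<gamma>" "0 < \<sigma>"
  shows "(\<integral>\<^sup>+s. ennreal (exp (\<sigma> * s - c * exp (\<gamma> * s))) \<partial>lborel)
    = ennreal (Gamma (\<sigma> / \<gamma>) / (\<gamma> * c powr (\<sigma> / \<gamma>)))"
proof -
  define \<tau> where "\<tau> = \<sigma> / \<gamma>"
  have \<tau>: "0 < \<tau>" "\<tau> * \<gamma> = \<sigma>" using assms by (auto simp: \<tau>_def)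
  define F where "F s = exp (\<tau> * s - exp s)" for s :: real
  have [measurable]: "F \<in> borel_measurable borel" unfolding F_def by measurable
  have "ennreal (Gamma \<tau>) = (\<integral>\<^sup>+t. ennreal (indicator {0..} t * t powr (\<tau> - 1) / exp t) \<partial>lborel)"
    by (rule Gamma_conv_nn_integral_real[OF \<tau>(1)])
  also have "\<dots> = (\<integral>\<^sup>+t. ennreal (F (ln t) / t) * indicator {0<..} t \<partial>lborel)"
  proof (rule nn_integral_cong_AE)
    show "AE t in lborel. ennreal (indicator {0..} t * t powr (\<tau> - 1) / exp t) = ennreal (F (ln t) / t) * indicator {0<..} t"
      using AE_lborel_singleton[of 0]
      by eventually_elim (auto simp: F_def powr_diff powr_def[of _ \<tau>] exp_diff split: split_indicator)
  qed
  also have "\<dots> = (\<integral>\<^sup>+s. ennreal (F s) \<partial>lborel)"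
    by (rule nn_integral_log_coordinate) measurable
  also have "\<dots> = ennreal \<gamma> * (\<integral>\<^sup>+s. ennreal (F (ln c + \<gamma> * s)) \<partial>lborel)"
    using assms by (subst nn_integral_real_affine[where c = \<gamma> and t = "ln c"]) auto
  also have "(\<lambda>s. F (ln c + \<gamma> * s)) = (\<lambda>s. c powr \<tau> * exp (\<sigma> * s - c * exp (\<gamma> * s)))"
    using assms \<tau> by (auto simp: F_def fun_eq_iff powr_def exp_add exp_diff algebra_simps simp flip: \<tau>(2))
  also have "ennreal \<gamma> * (\<integral>\<^sup>+s. ennreal (c powr \<tau> * exp (\<sigma> * s - c * exp (\<gamma> * s))) \<partial>lborel)
     = ennreal (\<gamma> * c powr \<tau>) * (\<integral>\<^sup>+s. ennreal (exp (\<sigma> * s - c * exp (\<gamma> * s))) \<partial>lborel)"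
    using assms by (simp add: ennreal_mult nn_integral_cmult mult.assoc)
  finally have *: "ennreal (Gamma \<tau>) = ennreal (\<gamma> * c powr \<tau>) * (\<integral>\<^sup>+s. ennreal (exp (\<sigma> * s - c * exp (\<gamma> * s))) \<partial>lborel)" .
  have pos: "0 < \<gamma> * c powr \<tau>" using assms by simp
  have "(\<integral>\<^sup>+s. ennreal (exp (\<sigma> * s - c * exp (\<gamma> * s))) \<partial>lborel)
     = ennreal (1 / (\<gamma> * c powr \<tau>)) * ennreal (Gamma \<tau>)"
    unfolding * mult.assoc[symmetric] ennreal_mult[symmetric, OF less_imp_le less_imp_le, OF divide_pos_pos[OF zero_less_one pos] pos]
    using assms by simp
  also have "\<dots> = ennreal (Gamma \<tau> / (\<gamma> * c powr \<tau>))"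
    using pos \<tau> by (simp add: ennreal_mult[symmetric] Gamma_real_nonneg)
  finally show ?thesis by (simp add: \<tau>_def)
qed

lemma hurwitz_zeta_summable:
  assumes "1 < s" "0 < a"
  shows "summable (\<lambda>j. 1 / (real j + a) powr s)"
proof -
  have "summable (\<lambda>j. real j powr (- s))" using assms by (simp add: summable_real_powr_iff)
  then have "summable (\<lambda>j. real (Suc j) powr (- s))" by (subst summable_Suc_iff)
  then have "summable (\<lambda>j. 1 / (real (Suc j) + a) powr s)"
  proof (rule summable_comparison_test'[where N = 0])
    fix j :: nat
    have "real (Suc j) powr s \<le> (real (Suc j) + a) powr s" using assms by (intro powr_mono2) auto
    then show "norm (1 / (real (Suc j) + a) powr s) \<le> real (Suc j) powr (- s)"
      by (simp add: powr_minus_divide frac_le)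
  qed
  then show ?thesis by (subst (asm) summable_Suc_iff)
qed

lemma
  assumes "0 \<le> \<alpha>" "0 < \<rho>" "0 < \<gamma>" "\<gamma> < \<sigma>"
  shows nn_integral_log_kern: "(\<integral>\<^sup>+s. ennreal (log_kern \<alpha> \<rho> \<gamma> \<sigma> s) \<partial>lborel) = ennreal (k_const \<alpha> \<rho> \<gamma> \<sigma>)"
    and k_const_nonneg: "0 \<le> k_const \<alpha> \<rho> \<gamma> \<sigma>"
    and k_const_eq: "k_const \<alpha> \<rho> \<gamma> \<sigma> = 2 * Gamma (\<sigma> / \<gamma>) / (\<gamma> * (2 * \<rho>) powr (\<sigma> / \<gamma>))
                * hurwitz_zeta (\<sigma> / \<gamma>) ((\<alpha> + \<rho>) / (2 * \<rho>))"
proof -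
  define \<tau> where "\<tau> = \<sigma> / \<gamma>"
  define a where "a = (\<alpha> + \<rho>) / (2 * \<rho>)"
  define c where "c j = \<alpha> + \<rho> * (2 * real j + 1)" for j
  define R where "R = 2 * Gamma \<tau> / (\<gamma> * (2 * \<rho>) powr \<tau>)"
  have \<tau>: "1 < \<tau>" and a: "0 < a" and c: "0 < c j" for j
    using assms by (auto simp: \<tau>_def a_def c_def intro!: add_nonneg_pos)
  have R: "0 \<le> R" using assms \<tau> by (simp add: R_def Gamma_real_nonneg)
  have c_eq: "c j = (2 * \<rho>) * (real j + a)" for j
    using assms by (simp add: c_def a_def field_simps)
  have "(\<integral>\<^sup>+s. ennreal (log_kern \<alpha> \<rho> \<gamma> \<sigma> s) \<partial>lborel) = (\<integral>\<^sup>+s. (\<Sum>j. ennreal (2 * exp (\<sigma> * s - c j * exp (\<gamma> * s)))) \<partial>lborel)"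
    using log_kern_sums[OF assms(2)]
    by (intro nn_integral_cong suminf_ennreal_eq[symmetric]) (auto simp: c_def)
  also have "\<dots> = (\<Sum>j. (\<integral>\<^sup>+s. ennreal (2 * exp (\<sigma> * s - c j * exp (\<gamma> * s))) \<partial>lborel))"
    by (rule nn_integral_suminf) measurable
  also have "\<dots> = (\<Sum>j. ennreal (R * (1 / (real j + a) powr \<tau>)))"
  proof (intro suminf_cong)
    fix j
    have "(\<integral>\<^sup>+s. ennreal (2 * exp (\<sigma> * s - c j * exp (\<gamma> * s))) \<partial>lborel)
        = ennreal 2 * (\<integral>\<^sup>+s. ennreal (exp (\<sigma> * s - c j * exp (\<gamma> * s))) \<partial>lborel)"
      by (subst nn_integral_cmult[symmetric]) (simp_all add: ennreal_mult')
    also have "\<dots> = ennreal (2 * (Gamma \<tau> / (\<gamma> * c j powr \<tau>)))"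
      using assms c[of j] by (subst ennreal_mult') (auto simp: nn_integral_Gamma_log \<tau>_def)
    also have "2 * (Gamma \<tau> / (\<gamma> * c j powr \<tau>)) = R * (1 / (real j + a) powr \<tau>)"
      using assms a unfolding c_eq R_def by (subst powr_mult) auto
    finally show "(\<integral>\<^sup>+s. ennreal (2 * exp (\<sigma> * s - c j * exp (\<gamma> * s))) \<partial>lborel) = ennreal (R * (1 / (real j + a) powr \<tau>))" .
  qed
  also have "\<dots> = ennreal (R * hurwitz_zeta \<tau> a)"
    unfolding hurwitz_zeta_def using hurwitz_zeta_summable[OF \<tau> a] R
    by (intro suminf_ennreal_eq sums_mult summable_sums) auto
  finally have total: "(\<integral>\<^sup>+s. ennreal (log_kern \<alpha> \<rho> \<gamma> \<sigma> s) \<partial>lborel) = ennreal (R * hurwitz_zeta \<tau> a)" .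
  have zeta: "0 \<le> hurwitz_zeta \<tau> a"
    unfolding hurwitz_zeta_def using hurwitz_zeta_summable[OF \<tau> a] by (intro suminf_nonneg) auto
  have "k_const \<alpha> \<rho> \<gamma> \<sigma> = (\<integral>t. indicator {0<..} t * (log_kern \<alpha> \<rho> \<gamma> \<sigma> (ln t) / t) \<partial>lborel)"
    unfolding k_const_def set_lebesgue_integral_def
  proof (intro Bochner_Integration.integral_cong refl)
    fix t :: real
    show "indicator {0<..} t *\<^sub>R (csch (\<rho> * t powr \<gamma>) / exp (\<alpha> * t powr \<gamma>) * t powr (\<sigma> - 1))
        = indicator {0<..} t * (log_kern \<alpha> \<rho> \<gamma> \<sigma> (ln t) / t)"
    proof (cases "0 < t")
      case True
      then have "t powr (\<sigma> - 1) = exp (\<sigma> * ln t) / t" by (simp add: powr_diff powr_def[of t \<sigma>])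
      then show ?thesis using True by (simp add: log_kern_def kern_def)
    qed simp
  qed
  also have "\<dots> = enn2real (\<integral>\<^sup>+t. ennreal (indicator {0<..} t * (log_kern \<alpha> \<rho> \<gamma> \<sigma> (ln t) / t)) \<partial>lborel)"
    using assms by (intro integral_eq_nn_integral) (auto simp: log_kern_nonneg split: split_indicator)
  also have "(\<integral>\<^sup>+t. ennreal (indicator {0<..} t * (log_kern \<alpha> \<rho> \<gamma> \<sigma> (ln t) / t)) \<partial>lborel)
      = (\<integral>\<^sup>+t. ennreal (log_kern \<alpha> \<rho> \<gamma> \<sigma> (ln t) / t) * indicator {0<..} t \<partial>lborel)"
    by (intro nn_integral_cong) (auto split: split_indicator)
  also have "\<dots> = ennreal (R * hurwitz_zeta \<tau> a)"
    by (simp add: nn_integral_log_coordinate total)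
  finally have k: "k_const \<alpha> \<rho> \<gamma> \<sigma> = R * hurwitz_zeta \<tau> a" using R zeta by simp
  then show "(\<integral>\<^sup>+s. ennreal (log_kern \<alpha> \<rho> \<gamma> \<sigma> s) \<partial>lborel) = ennreal (k_const \<alpha> \<rho> \<gamma> \<sigma>)"
    using total by simp
  show "0 \<le> k_const \<alpha> \<rho> \<gamma> \<sigma>" using k R zeta by simp
  show "k_const \<alpha> \<rho> \<gamma> \<sigma> = 2 * Gamma (\<sigma> / \<gamma>) / (\<gamma> * (2 * \<rho>) powr (\<sigma> / \<gamma>))
                * hurwitz_zeta (\<sigma> / \<gamma>) ((\<alpha> + \<rho>) / (2 * \<rho>))"
    using k by (simp add: R_def \<tau>_def a_def)
qed

section \<open>The Hermite-Hadamard inequality and the discrete marginal\<close>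

lemma powr_concave:
  fixes p :: real
  assumes "0 \<le> p" "p \<le> 1"
  shows "concave_on {0<..} (\<lambda>x. x powr p)"
proof (rule f''_le0_imp_concave)
  fix x :: real assume x: "x \<in> {0<..}"
  show "((\<lambda>x. x powr p) has_real_derivative p * x powr (p - 1)) (at x)"
    "((\<lambda>x. p * x powr (p - 1)) has_real_derivative p * ((p - 1) * x powr (p - 1 - 1))) (at x)"
    using x by (auto intro!: derivative_eq_intros)
  show "p * ((p - 1) * x powr (p - 1 - 1)) \<le> 0"
    using assms by (intro mult_nonneg_nonpos mult_nonpos_nonneg) auto
qed auto

lemma midpoint_concave:
  fixes f :: "real \<Rightarrow> real"
  assumes "concave_on S f" "a \<in> S" "b \<in> S"
  shows "f a + f b \<le> 2 * f ((a + b) / 2)"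
proof -
  have "- f ((1 - 1/2) *\<^sub>R a + (1/2) *\<^sub>R b) \<le> (1 - 1/2) * (- f a) + (1/2) * (- f b)"
    using assms unfolding concave_on_def by (intro convex_onD) auto
  moreover have "(1 - 1/2) *\<^sub>R a + (1/2) *\<^sub>R b = (a + b) / 2" by (simp add: field_simps)
  ultimately have "- f ((a + b) / 2) \<le> (1 - 1/2) * (- f a) + (1/2) * (- f b)" by metis
  then show ?thesis by simp
qed

lemma midpoint_exp:
  fixes x y z :: real
  assumes "2 * z \<le> x + y"
  shows "2 * exp z \<le> exp x + exp y"
proof -
  have "0 \<le> (exp (x / 2) - exp (y / 2))\<^sup>2" by simp
  then have "2 * exp ((x + y) / 2) \<le> exp x + exp y"
    by (simp add: power2_eq_square algebra_simps add_divide_distrib flip: exp_add)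
  moreover have "exp z \<le> exp ((x + y) / 2)" using assms by simp
  ultimately show ?thesis by linarith
qed

text \<open>
  The \<open>j\<close>-th term of the series for \<open>log_kern (s + ln v) / v\<close> is \<open>2 exp(e\<^sub>j(v))\<close> with
  \<open>e\<^sub>j(v) = \<sigma>s - (1 - \<sigma>) ln v - C\<^sub>j v^\<gamma>\<close>. Because \<open>\<gamma> \<le> 1\<close> and \<open>\<sigma> \<le> 1\<close>, the exponent \<open>e\<^sub>j\<close> is decreasing and
  convex, and both properties pass to its exponential and to the sum. This is where the
  upper limit on \<open>\<sigma>\<close> enters.
\<close>
lemma
  assumes "0 \<le> \<alpha>" "0 < \<rho>" "0 < \<gamma>" "\<gamma> \<le> 1" "\<sigma> \<le> 1"
  shows log_kern_antimono: "\<And>v w. 0 < v \<Longrightarrow> v \<le> w \<Longrightarrow> log_kern \<alpha> \<rho> \<gamma> \<sigma> (s + ln w) / w \<le> log_kern \<alpha> \<rho> \<gamma> \<sigma> (s + ln v) / v"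
    and log_kern_midpoint: "\<And>v w. 0 < v \<Longrightarrow> 0 < w \<Longrightarrow>
      2 * (log_kern \<alpha> \<rho> \<gamma> \<sigma> (s + ln ((v + w) / 2)) / ((v + w) / 2))
        \<le> log_kern \<alpha> \<rho> \<gamma> \<sigma> (s + ln v) / v + log_kern \<alpha> \<rho> \<gamma> \<sigma> (s + ln w) / w"
proof -
  define C where "C j = (\<alpha> + \<rho> * (2 * real j + 1)) * exp (\<gamma> * s)" for j
  have C: "0 \<le> C j" for j using assms by (auto simp: C_def)
  define e where "e j v = \<sigma> * s - (1 - \<sigma>) * ln v - C j * v powr \<gamma>" for j v
  have sums: "(\<lambda>j. 2 * exp (e j v)) sums (log_kern \<alpha> \<rho> \<gamma> \<sigma> (s + ln v) / v)" if "0 < v" for v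
  proof -
    have "(\<lambda>j. 2 * exp (\<sigma> * (s + ln v) - (\<alpha> + \<rho> * (2 * real j + 1)) * exp (\<gamma> * (s + ln v))) / v)
        sums (log_kern \<alpha> \<rho> \<gamma> \<sigma> (s + ln v) / v)"
      by (intro sums_divide log_kern_sums assms)
    moreover have "2 * exp (\<sigma> * (s + ln v) - (\<alpha> + \<rho> * (2 * real j + 1)) * exp (\<gamma> * (s + ln v))) / v = 2 * exp (e j v)" for j
    proof -
      have "exp (e j v) = exp (\<sigma> * (s + ln v) - (\<alpha> + \<rho> * (2 * real j + 1)) * exp (\<gamma> * (s + ln v)) - ln v)"
        using that by (simp add: e_def C_def powr_def exp_add algebra_simps)
      then show ?thesis using that by (simp add: exp_diff)
    qed
    ultimately show ?thesis by (simp only:)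
  qed
  show "log_kern \<alpha> \<rho> \<gamma> \<sigma> (s + ln w) / w \<le> log_kern \<alpha> \<rho> \<gamma> \<sigma> (s + ln v) / v" if "0 < v" "v \<le> w" for v w
  proof (rule sums_le[OF _ sums sums])
    fix j
    have "(1 - \<sigma>) * ln v \<le> (1 - \<sigma>) * ln w" "C j * v powr \<gamma> \<le> C j * w powr \<gamma>"
      using that assms C by (auto intro!: mult_left_mono powr_mono2)
    then have "e j w \<le> e j v" by (simp add: e_def)
    then show "2 * exp (e j w) \<le> 2 * exp (e j v)" by simp
  qed (use that in auto)
  show "2 * (log_kern \<alpha> \<rho> \<gamma> \<sigma> (s + ln ((v + w) / 2)) / ((v + w) / 2))
        \<le> log_kern \<alpha> \<rho> \<gamma> \<sigma> (s + ln v) / v + log_kern \<alpha> \<rho> \<gamma> \<sigma> (s + ln w) / w" if "0 < v" "0 < w" for v w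
  proof (rule sums_le[OF _ sums_mult[OF sums] sums_add[OF sums sums]])
    fix j
    have "(1 - \<sigma>) * (ln v + ln w) \<le> (1 - \<sigma>) * (2 * ln ((v + w) / 2))"
      "C j * (v powr \<gamma> + w powr \<gamma>) \<le> C j * (2 * ((v + w) / 2) powr \<gamma>)"
      using that assms C
      by (intro mult_left_mono midpoint_concave[OF ln_concave] midpoint_concave[OF powr_concave]; simp)+
    then have "2 * e j ((v + w) / 2) \<le> e j v + e j w" by (simp add: e_def algebra_simps)
    then have "2 * exp (e j ((v + w) / 2)) \<le> exp (e j v) + exp (e j w)" by (rule midpoint_exp)
    then show "2 * (2 * exp (e j ((v + w) / 2))) \<le> 2 * exp (e j v) + 2 * exp (e j w)" by simp
  qed (use that in auto)
qed

text \<open>Averaging the integral with its reflection in the midpoint reduces the inequality to the pointwise one.\<close>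
lemma hermite_hadamard_midpoint:
  fixes g :: "real \<Rightarrow> real"
  assumes [measurable]: "g \<in> borel_measurable borel"
    and g_nonneg: "\<And>v. 0 < v \<Longrightarrow> 0 \<le> g v"
    and g_mid: "\<And>v w. 0 < v \<Longrightarrow> 0 < w \<Longrightarrow> 2 * g ((v + w) / 2) \<le> g v + g w"
    and ab: "0 \<le> a" "a < b"
  shows "ennreal ((b - a) * g ((a + b) / 2)) \<le> (\<integral>\<^sup>+v. ennreal (g v) * indicator {a<..<b} v \<partial>lborel)"
proof -
  define I where "I = (\<integral>\<^sup>+v. ennreal (g v) * indicator {a<..<b} v \<partial>lborel)"
  have refl: "I = (\<integral>\<^sup>+v. ennreal (g (a + b - v)) * indicator {a<..<b} v \<partial>lborel)"
  proof -
    have "I = (\<integral>\<^sup>+v. ennreal (g (a + b - v)) * indicator {a<..<b} (a + b - v) \<partial>lborel)"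
      unfolding I_def by (subst nn_integral_real_affine[where c = "-1" and t = "a + b"]) auto
    also have "\<dots> = (\<integral>\<^sup>+v. ennreal (g (a + b - v)) * indicator {a<..<b} v \<partial>lborel)"
      by (intro nn_integral_cong) (auto split: split_indicator)
    finally show ?thesis .
  qed
  have m: "0 \<le> g ((a + b) / 2)" using ab by (intro g_nonneg) simp
  have "2 * ennreal ((b - a) * g ((a + b) / 2)) = (\<integral>\<^sup>+v. ennreal (2 * g ((a + b) / 2)) * indicator {a<..<b} v \<partial>lborel)"
    using ab m by (subst nn_integral_cmult) (auto simp: ennreal_mult mult_ac)
  also have "\<dots> \<le> (\<integral>\<^sup>+v. ennreal (g v) * indicator {a<..<b} v + ennreal (g (a + b - v)) * indicator {a<..<b} v \<partial>lborel)"
  proof (intro nn_integral_mono)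
    fix v
    show "ennreal (2 * g ((a + b) / 2)) * indicator {a<..<b} v
        \<le> ennreal (g v) * indicator {a<..<b} v + ennreal (g (a + b - v)) * indicator {a<..<b} v"
    proof (cases "v \<in> {a<..<b}")
      case True
      then have "0 < v" "0 < a + b - v" using ab by auto
      then show ?thesis
        using g_mid[of v "a + b - v"] True g_nonneg[of v] g_nonneg[of "a + b - v"]
        by (simp add: ennreal_leI flip: ennreal_plus)
    qed simp
  qed
  also have "\<dots> = I + I"
    by (subst nn_integral_add) (auto simp: refl[symmetric], simp add: I_def)
  also have "\<dots> = 2 * I" by (simp add: mult_2)
  finally show ?thesis
    unfolding I_def[symmetric] by (subst (asm) ennreal_mult_le_mult_iff) auto
qed

text \<open>Monotonicity is used to move the nodes \<open>v n\<close> back to the midpoints.\<close>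
lemma suminf_le_integral:
  fixes g :: "real \<Rightarrow> real" and V v w :: "nat \<Rightarrow> real"
  assumes g_meas [measurable]: "g \<in> borel_measurable borel"
    and g_nonneg: "\<And>v. 0 < v \<Longrightarrow> 0 \<le> g v"
    and g_mid: "\<And>v w. 0 < v \<Longrightarrow> 0 < w \<Longrightarrow> 2 * g ((v + w) / 2) \<le> g v + g w"
    and g_anti: "\<And>v w. 0 < v \<Longrightarrow> v \<le> w \<Longrightarrow> g w \<le> g v"
    and V: "0 \<le> V 0" "\<And>n. V n < V (Suc n)"
    and v: "\<And>n. (V n + V (Suc n)) / 2 \<le> v n"
  shows "(\<Sum>n. ennreal ((V (Suc n) - V n) * g (v n))) \<le> (\<integral>\<^sup>+v. ennreal (g v) * indicator {0<..} v \<partial>lborel)"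
proof -
  define D where "D = density lborel (\<lambda>v. ennreal (g v))"
  have V_mono: "strict_mono V" by (rule strict_mono_Suc_iff[THEN iffD2]) (use V in auto)
  have V_nonneg: "0 \<le> V n" for n using V(1) strict_mono_less_eq[OF V_mono, of 0 n] by simp
  have "(\<Sum>n. ennreal ((V (Suc n) - V n) * g (v n))) \<le> (\<Sum>n. emeasure D {V n<..<V (Suc n)})"
  proof (intro suminf_le)
    fix n
    have "0 < (V n + V (Suc n)) / 2" using V_nonneg[of n] V(2)[of n] by simp
    then have "(V (Suc n) - V n) * g (v n) \<le> (V (Suc n) - V n) * g ((V n + V (Suc n)) / 2)"
      using V(2)[of n] v[of n] by (intro mult_left_mono g_anti) auto
    then have "ennreal ((V (Suc n) - V n) * g (v n)) \<le> ennreal ((V (Suc n) - V n) * g ((V n + V (Suc n)) / 2))"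
      by (rule ennreal_leI)
    also have "\<dots> \<le> emeasure D {V n<..<V (Suc n)}"
      unfolding D_def using hermite_hadamard_midpoint[OF g_meas g_nonneg g_mid V_nonneg V(2), of n]
      by (subst emeasure_density) auto
    finally show "ennreal ((V (Suc n) - V n) * g (v n)) \<le> emeasure D {V n<..<V (Suc n)}" .
  qed auto
  also have "\<dots> = emeasure D (\<Union>n. {V n<..<V (Suc n)})"
  proof (rule suminf_emeasure)
    have "{V i<..<V (Suc i)} \<inter> {V j<..<V (Suc j)} = {}" if "i < j" for i j
      using that strict_mono_less_eq[OF V_mono, of "Suc i" j] by auto
    then show "disjoint_family (\<lambda>n. {V n<..<V (Suc n)})"
      unfolding disjoint_family_on_def by (metis linorder_neqE_nat Int_commute)
  qed (auto simp: D_def)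
  also have "\<dots> \<le> emeasure D {0<..}"
    by (rule emeasure_mono) (auto simp: D_def intro: le_less_trans[OF V_nonneg])
  also have "\<dots> = (\<integral>\<^sup>+v. ennreal (g v) * indicator {0<..} v \<partial>lborel)"
    unfolding D_def by (rule emeasure_density) auto
  finally show ?thesis .
qed

text \<open>
  For fixed \<open>s\<close>, both bounds compare with \<open>\<integral> log_kern (s + ln v) / v dv\<close> over \<open>v > 0\<close>, which equals \<open>k(\<sigma>)\<close> for every \<open>s\<close>.
  The first keeps only \<open>0 < v < 1\<close>, where the integrand is at least its value at \<open>v = 1\<close>.
\<close>
lemma
  assumes "0 \<le> \<alpha>" "0 < \<rho>" "0 < \<gamma>" "\<gamma> < \<sigma>" "\<sigma> \<le> 1"
  shows log_kern_le: "log_kern \<alpha> \<rho> \<gamma> \<sigma> s \<le> k_const \<alpha> \<rho> \<gamma> \<sigma>"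
    and log_kern_suminf_le:
      "\<And>V v. 0 \<le> V 0 \<Longrightarrow> (\<And>n. V n < V (Suc n)) \<Longrightarrow> (\<And>n. (V n + V (Suc n)) / 2 \<le> v n) \<Longrightarrow>
        (\<Sum>n. ennreal ((V (Suc n) - V n) * (log_kern \<alpha> \<rho> \<gamma> \<sigma> (s + ln (v n)) / v n))) \<le> ennreal (k_const \<alpha> \<rho> \<gamma> \<sigma>)"
proof -
  have "\<gamma> \<le> 1" using assms by simp
  note anti = log_kern_antimono[OF assms(1-3) this assms(5)]
    and mid = log_kern_midpoint[OF assms(1-3) this assms(5)]
  define g where "g v = log_kern \<alpha> \<rho> \<gamma> \<sigma> (s + ln v) / v" for v
  have [measurable]: "g \<in> borel_measurable borel" unfolding g_def by measurable
  have g_nonneg: "0 \<le> g v" if "0 < v" for v using assms that by (simp add: g_def log_kern_nonneg)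
  have total: "(\<integral>\<^sup>+v. ennreal (g v) * indicator {0<..} v \<partial>lborel) = ennreal (k_const \<alpha> \<rho> \<gamma> \<sigma>)"
  proof -
    have "(\<integral>\<^sup>+v. ennreal (g v) * indicator {0<..} v \<partial>lborel) = (\<integral>\<^sup>+y. ennreal (log_kern \<alpha> \<rho> \<gamma> \<sigma> (s + y)) \<partial>lborel)"
      unfolding g_def by (rule nn_integral_log_coordinate[where F = "\<lambda>y. log_kern \<alpha> \<rho> \<gamma> \<sigma> (s + y)"]) measurable
    also have "\<dots> = (\<integral>\<^sup>+y. ennreal (log_kern \<alpha> \<rho> \<gamma> \<sigma> y) \<partial>lborel)"
      using nn_integral_real_affine[of "\<lambda>y. ennreal (log_kern \<alpha> \<rho> \<gamma> \<sigma> y)" 1 s] by simp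
    finally show ?thesis using assms by (simp add: nn_integral_log_kern)
  qed
  show "log_kern \<alpha> \<rho> \<gamma> \<sigma> s \<le> k_const \<alpha> \<rho> \<gamma> \<sigma>"
  proof -
    have "ennreal (log_kern \<alpha> \<rho> \<gamma> \<sigma> s) = (\<integral>\<^sup>+v. ennreal (g 1) * indicator {0<..<1::real} v \<partial>lborel)"
      by (subst nn_integral_cmult) (auto simp: g_def)
    also have "\<dots> \<le> (\<integral>\<^sup>+v. ennreal (g v) * indicator {0<..} v \<partial>lborel)"
      using anti[of _ 1 s] by (intro nn_integral_mono) (auto simp: g_def intro!: ennreal_leI split: split_indicator)
    finally show ?thesis using total k_const_nonneg[of \<alpha> \<rho> \<gamma> \<sigma>] assms by simp
  qed
  fix V v :: "nat \<Rightarrow> real"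
  assume "0 \<le> V 0" "\<And>n. V n < V (Suc n)" "\<And>n. (V n + V (Suc n)) / 2 \<le> v n"
  then have "(\<Sum>n. ennreal ((V (Suc n) - V n) * g (v n))) \<le> (\<integral>\<^sup>+v. ennreal (g v) * indicator {0<..} v \<partial>lborel)"
    by (intro suminf_le_integral g_nonneg) (auto simp: g_def anti mid[simplified])
  then show "(\<Sum>n. ennreal ((V (Suc n) - V n) * (log_kern \<alpha> \<rho> \<gamma> \<sigma> (s + ln (v n)) / v n))) \<le> ennreal (k_const \<alpha> \<rho> \<gamma> \<sigma>)"
    unfolding total by (simp add: g_def)
qed

section \<open>Partial sums and tails of the weight series\<close>

lemma V_seq_Suc: "V_seq \<nu> (Suc n) = V_seq \<nu> n + \<nu> (Suc n)"
  by (simp add: V_seq_def)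

text \<open>At half-integers the primitive \<open>V\<close> of the step function equals the partial sum, so its divergence
  passes to the partial sums.\<close>
lemma V_fun_half_integer:
  "set_integrable lborel {1/2<..real n + 1/2} (nu_step \<nu>) \<and> V_fun \<nu> (real n + 1/2) = V_seq \<nu> n"
proof (induction n)
  case 0
  then show ?case by (simp add: V_fun_def V_seq_def set_integrable_def set_lebesgue_integral_def)
next
  case (Suc n)
  have step: "nu_step \<nu> t = \<nu> (Suc n)" if "t \<in> {real n + 1/2<..real (Suc n) + 1/2}" for t
  proof -
    have "\<lceil>t - 1/2\<rceil> = int (Suc n)" using that by (intro ceiling_unique) auto
    then show ?thesis by (simp only: nu_step_def nat_int)
  qed
  have const: "set_integrable lborel {real n + 1/2<..real (Suc n) + 1/2} (\<lambda>_. \<nu> (Suc n))"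
    unfolding set_integrable_def by simp
  have 1: "set_integrable lborel {real n + 1/2<..real (Suc n) + 1/2} (nu_step \<nu>)"
    by (subst set_integrable_cong[OF refl refl step]) (use const in auto)
  have 2: "(LBINT t:{real n + 1/2<..real (Suc n) + 1/2}. nu_step \<nu> t) = \<nu> (Suc n)"
  proof -
    have "(LBINT t:{real n + 1/2<..real (Suc n) + 1/2}. nu_step \<nu> t)
        = (LBINT t:{real n + 1/2<..real (Suc n) + 1/2}. \<nu> (Suc n))"
      using step by (intro set_lebesgue_integral_cong) auto
    then show ?thesis by (simp add: set_lebesgue_integral_def)
  qed
  have un: "{1/2<..real (Suc n) + 1/2} = {1/2<..real n + 1/2} \<union> {real n + 1/2<..real (Suc n) + 1/2}"
    by auto
  show ?case
    unfolding V_fun_def un using Suc.IH 1 2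
    by (auto simp: V_seq_Suc V_fun_def set_integral_Un intro!: set_integrable_Un)
qed

lemma V_seq_at_top:
  assumes "filterlim (V_fun \<nu>) at_top at_top"
  shows "filterlim (V_seq \<nu>) at_top sequentially"
proof -
  have "filterlim (\<lambda>n. real n + 1/2) at_top sequentially"
    by (rule filterlim_at_top_mono[OF filterlim_real_sequentially]) auto
  then have "filterlim (\<lambda>n. V_fun \<nu> (real n + 1/2)) at_top sequentially"
    by (rule filterlim_compose[OF assms])
  then show ?thesis using V_fun_half_integer by simp
qed

lemma powr_diff_le:
  fixes a b \<epsilon> :: real
  assumes "0 < a" "a \<le> b" "0 < \<epsilon>"
  shows "(a powr (- \<epsilon>) - b powr (- \<epsilon>)) / \<epsilon> \<le> (b - a) * a powr (- 1 - \<epsilon>)"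
proof (cases "a = b")
  case False
  have "((\<lambda>z. z powr (- \<epsilon>)) has_real_derivative - \<epsilon> * z powr (- 1 - \<epsilon>)) (at z)" if "0 < z" for z
    using has_real_derivative_powr[OF that, of "- \<epsilon>"] by (simp add: minus_diff_commute)
  then have "\<exists>z. a < z \<and> z < b \<and> b powr (- \<epsilon>) - a powr (- \<epsilon>) = (b - a) * (- \<epsilon> * z powr (- 1 - \<epsilon>))"
    using assms False by (intro MVT2) auto
  then obtain z where z: "a < z" "b powr (- \<epsilon>) - a powr (- \<epsilon>) = (b - a) * (- \<epsilon> * z powr (- 1 - \<epsilon>))"
    by blast
  have "(a powr (- \<epsilon>) - b powr (- \<epsilon>)) = \<epsilon> * ((b - a) * z powr (- 1 - \<epsilon>))"
    using z by (simp add: algebra_simps)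
  then have "(a powr (- \<epsilon>) - b powr (- \<epsilon>)) / \<epsilon> = (b - a) * z powr (- 1 - \<epsilon>)"
    using assms by simp
  also have "\<dots> \<le> (b - a) * a powr (- 1 - \<epsilon>)"
    using assms z by (intro mult_left_mono powr_mono2') auto
  finally show ?thesis .
qed simp

text \<open>
  From \<open>n0\<close> on, the term \<open>d\<^sub>n v\<^sub>n^(-1 - \<epsilon>)\<close> dominates the integral of \<open>v^(-1 - \<epsilon>)\<close> over the following interval
  \<open>[V\<^sub>n, V\<^sub>n\<^sub>+\<^sub>1]\<close>, because \<open>d\<close> decreases and \<open>v\<^sub>n \<le> V\<^sub>n\<close>; these integrals telescope.
\<close>
lemma suminf_tail_lower_bound:
  fixes V v d T :: "nat \<Rightarrow> real"
  assumes V_pos: "\<And>n. 0 < V n" and V_Suc: "\<And>n. V (Suc n) = V n + d (Suc n)"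
    and V_top: "filterlim V at_top sequentially"
    and v: "\<And>n. 0 < v n" "\<And>n. v n \<le> V n"
    and d: "\<And>n. 0 < d n" "\<And>n. n0 \<le> n \<Longrightarrow> d (Suc n) \<le> d n"
    and T: "summable T" "\<And>n. 0 \<le> T n" "\<And>n. n0 \<le> n \<Longrightarrow> c * (d n * v n powr (- 1 - \<epsilon>)) \<le> T n"
    and "0 \<le> c" "0 < \<epsilon>"
  shows "c * (V n0 powr (- \<epsilon>) / \<epsilon>) \<le> suminf T"
proof -
  define h where "h n = V (n + n0) powr (- \<epsilon>) / \<epsilon>" for n
  have "(\<lambda>n. V (n + n0) powr (- \<epsilon>)) \<longlonglongrightarrow> 0"
    using V_top \<open>0 < \<epsilon>\<close>
    by (intro tendsto_neg_powr filterlim_compose[OF V_top] filterlim_add_const_nat_at_top) auto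
  then have "h \<longlonglongrightarrow> 0" unfolding h_def by (rule tendsto_divide_zero)
  then have "(\<lambda>n. h n - h (Suc n)) sums (h 0 - 0)" by (rule telescope_sums')
  then have sums: "(\<lambda>n. c * (h n - h (Suc n))) sums (c * (h 0 - 0))" by (rule sums_mult)
  have le: "c * (h n - h (Suc n)) \<le> T (n + n0)" for n
  proof -
    let ?m = "n + n0"
    have "h n - h (Suc n) \<le> (V (Suc ?m) - V ?m) * V ?m powr (- 1 - \<epsilon>)"
      using powr_diff_le[of "V ?m" "V (Suc ?m)" \<epsilon>] V_pos[of ?m] V_Suc[of ?m] d(1)[of "Suc ?m"] \<open>0 < \<epsilon>\<close>
      by (simp add: h_def diff_divide_distrib)
    also have "\<dots> \<le> d ?m * v ?m powr (- 1 - \<epsilon>)"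
      using V_Suc[of ?m] d(1)[of "Suc ?m"] d(2)[of ?m] d(1)[of ?m] v[of ?m] V_pos[of ?m] \<open>0 < \<epsilon>\<close>
      by (intro mult_mono powr_mono2') auto
    finally show ?thesis using T(3)[of ?m] \<open>0 \<le> c\<close> by (auto intro: order_trans[OF mult_left_mono])
  qed
  have "c * (V n0 powr (- \<epsilon>) / \<epsilon>) = (\<Sum>n. c * (h n - h (Suc n)))"
    using sums_unique[OF sums] by (simp add: h_def)
  also have "\<dots> \<le> (\<Sum>n. T (n + n0))"
    using sums_summable[OF sums] T(1) le by (intro suminf_le) (auto simp: summable_iff_shift)
  also have "\<dots> \<le> suminf T"
    using suminf_split_initial_segment[OF T(1), of n0] sum_nonneg[of "{..<n0}" T] T(2) by simp
  finally show ?thesis .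
qed

lemma nn_integral_exp_neg_ray:
  assumes "0 < \<epsilon>"
  shows "(\<integral>\<^sup>+s. ennreal (exp (\<epsilon> * s)) * indicator {..0::real} s \<partial>lborel) = ennreal (1 / \<epsilon>)"
proof -
  have "(\<integral>\<^sup>+s. ennreal (exp (\<epsilon> * s)) * indicator {..0::real} s \<partial>lborel)
      = (\<integral>\<^sup>+s. ennreal (exp (- \<epsilon> * s)) * indicator {0..} s \<partial>lborel)"
    by (subst nn_integral_real_affine[where c = "-1" and t = 0])
       (auto intro!: nn_integral_cong split: split_indicator)
  also have "\<dots> = ennreal (0 - (- exp (- \<epsilon> * 0) / \<epsilon>))"
  proof (rule nn_integral_FTC_atLeast)
    show "((\<lambda>s. - exp (- \<epsilon> * s) / \<epsilon>) \<longlongrightarrow> 0) at_top"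
    proof -
      have "filterlim (\<lambda>s. - \<epsilon> * s) at_bot at_top"
        using assms by (intro filterlim_tendsto_neg_mult_at_bot[OF tendsto_const] filterlim_ident) auto
      then have "((\<lambda>s. exp (- \<epsilon> * s)) \<longlongrightarrow> 0) at_top" by (rule filterlim_compose[OF exp_at_bot])
      then have "((\<lambda>s. - exp (- \<epsilon> * s) / \<epsilon>) \<longlongrightarrow> - 0 / \<epsilon>) at_top"
        using assms by (intro tendsto_intros) auto
      then show ?thesis by simp
    qed
  qed (use assms in \<open>auto intro!: derivative_eq_intros\<close>)
  finally show ?thesis by simp
qed

text \<open>Only positive reals \<open>c\<close> are tested, since the near-extremal functions below exist for those.\<close>
lemma ereal_le_by_density:
  assumes "0 < K" "\<And>c. 0 < c \<Longrightarrow> c < K \<Longrightarrow> ereal c \<le> Z"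
  shows "ereal K \<le> Z"
proof (rule dense_le)
  fix x assume x: "x < ereal K"
  have half: "ereal (K / 2) \<le> Z" using assms by simp
  show "x \<le> Z"
  proof (cases x)
    case (real r)
    show ?thesis
    proof (cases "0 < r")
      case False
      then have "x \<le> ereal (K / 2)" using real assms by simp
      then show ?thesis using half by (rule order_trans)
    qed (use real x assms in auto)
  qed (use x in auto)
qed

section \<open>The normalised operator\<close>

text \<open>The index \<open>n\<close> of \<open>W\<close>, \<open>N\<close> and \<open>k\<close> below starts at \<open>0\<close> and stands for the index \<open>n + 1\<close> of the sequences \<open>\<nu>\<close> and \<open>\<nu>t\<close>.\<close>
locale half_discrete =
  fixes \<alpha> \<rho> \<gamma> \<sigma> \<delta> p q :: real
    and \<mu> :: "real \<Rightarrow> real"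
    and \<nu> \<nu>t :: "nat \<Rightarrow> real"
  assumes kernel_params: "0 \<le> \<alpha>" "0 < \<rho>" "0 < \<gamma>" "\<gamma> < \<sigma>" "\<sigma> \<le> 1"
    and delta: "\<delta> \<in> {-1, 1}"
    and pq: "1 < p" "1 / p + 1 / q = 1"
    and nu_pos: "\<And>n. 1 \<le> n \<Longrightarrow> 0 < \<nu> n"
    and nut: "\<And>n. 1 \<le> n \<Longrightarrow> \<nu>t n \<in> {0 .. \<nu> n / 2}"
    and mu_pos: "\<And>x. 0 < x \<Longrightarrow> 0 < \<mu> x"
    and mu_cont: "continuous_on {0<..} \<mu>"
    and U_finite: "\<And>x. 0 \<le> x \<Longrightarrow> set_integrable lborel {0<..x} \<mu>"
    and nu_decr: "\<exists>n0\<ge>1. \<forall>n\<ge>n0. \<nu> (Suc n) \<le> \<nu> n"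
    and U_inf: "U_infinity \<mu> = \<infinity>"
    and V_inf: "filterlim (V_fun \<nu>) at_top at_top"
begin

abbreviation "U \<equiv> U_fun \<mu>"

definition W where "W n = V_tilde \<nu> \<nu>t (Suc n)"

definition L where "L x = \<delta> * ln (U x)"

definition M where "M = density (lebesgue_on {0<..}) (\<lambda>x. ennreal (\<mu> x / U x))"

definition N where "N = density (count_space UNIV) (\<lambda>n. ennreal (\<nu> (Suc n) / W n))"

definition k where "k x n = log_kern \<alpha> \<rho> \<gamma> \<sigma> (L x + ln (W n))"

definition K where "K = k_const \<alpha> \<rho> \<gamma> \<sigma>"

lemma U_pos: "0 < x \<Longrightarrow> 0 < U x"
  and U_deriv: "0 < x \<Longrightarrow> (U has_real_derivative \<mu> x) (at x)"
  and U_0: "(\<lambda>n. U (1 / real (Suc n))) \<longlonglongrightarrow> 0"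
  and U_top: "filterlim (\<lambda>n. U (real (Suc n))) at_top sequentially"
  using U_fun_pos[of \<mu> x] U_fun_deriv[of \<mu> x] U_fun_tendsto_0[of \<mu>] U_fun_at_top[of \<mu>]
    mu_pos mu_cont U_finite U_inf by blast+

lemma L_measurable [measurable]: "L \<in> borel_measurable M"
  and distr_L: "distr M borel L = lborel"
  and dens_measurable [measurable]: "(\<lambda>x. \<mu> x / U x) \<in> borel_measurable (lebesgue_on {0<..})"
proof -
  have "L = (\<lambda>x. \<delta> * ln (U x))" by (simp add: L_def fun_eq_iff)
  then show "L \<in> borel_measurable M" "distr M borel L = lborel"
    "(\<lambda>x. \<mu> x / U x) \<in> borel_measurable (lebesgue_on {0<..})"
    unfolding M_def
    using distr_log_primitive[of U \<mu> \<delta>, OF U_deriv U_pos mu_pos mu_cont U_0 U_top delta] by simp_all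
qed

lemma space_M: "space M = {0<..}"
  by (simp add: M_def)

lemma V_pos: "0 < V_seq \<nu> (Suc n)"
  unfolding V_seq_def by (rule sum_pos) (auto intro: nu_pos)

lemma V_nonneg: "0 \<le> V_seq \<nu> n"
  using V_pos[of "n - 1"] by (cases n) (auto simp: V_seq_def)

lemma W_bounds:
  "(V_seq \<nu> n + V_seq \<nu> (Suc n)) / 2 \<le> W n" "W n \<le> V_seq \<nu> (Suc n)" "0 < W n"
proof -
  show 1: "(V_seq \<nu> n + V_seq \<nu> (Suc n)) / 2 \<le> W n" "W n \<le> V_seq \<nu> (Suc n)"
    using nut[of "Suc n"] by (auto simp: W_def V_tilde_def V_seq_Suc)
  have "0 < (V_seq \<nu> n + V_seq \<nu> (Suc n)) / 2"
    by (simp add: add_nonneg_pos V_nonneg V_pos)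
  then show "0 < W n" using 1(1) by (rule less_le_trans)
qed

lemma W_at_top: "filterlim W at_top sequentially"
proof (rule filterlim_at_top_mono)
  show "filterlim (\<lambda>n. (1/2) * V_seq \<nu> (Suc n)) at_top sequentially"
    by (intro filterlim_tendsto_pos_mult_at_top[OF tendsto_const]
        filterlim_compose[OF V_seq_at_top[OF V_inf] filterlim_Suc]) auto
  have "(1/2) * V_seq \<nu> (Suc n) \<le> W n" for n
    using W_bounds(1)[of n] V_nonneg[of n] by simp
  then show "\<forall>\<^sub>F n in sequentially. (1/2) * V_seq \<nu> (Suc n) \<le> W n" by simp
qed

lemma mass_pos: "0 < \<nu> (Suc n) / W n"
  using W_bounds nu_pos by simp

lemma nn_integral_L:
  assumes "f \<in> borel_measurable borel"
  shows "(\<integral>\<^sup>+x. f (L x) \<partial>M) = (\<integral>\<^sup>+s. f s \<partial>lborel)"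
  using assms by (subst distr_L[symmetric], subst nn_integral_distr) auto

lemma k_nonneg: "0 \<le> k x n"
  using kernel_params by (simp add: k_def log_kern_nonneg)

lemma k_le: "k x n \<le> K"
  using kernel_params by (simp add: k_def K_def log_kern_le)

lemma K_pos: "0 < K"
proof -
  have "0 < log_kern \<alpha> \<rho> \<gamma> \<sigma> 0" using kernel_params by (simp add: log_kern_def kern_def csch_def)
  also have "\<dots> \<le> K" unfolding K_def using kernel_params by (rule log_kern_le)
  finally show ?thesis .
qed

lemma marginal_M: "(\<integral>\<^sup>+x. ennreal (k x n) \<partial>M) = ennreal K"
proof -
  have "(\<integral>\<^sup>+x. ennreal (k x n) \<partial>M) = (\<integral>\<^sup>+s. ennreal (log_kern \<alpha> \<rho> \<gamma> \<sigma> (s + ln (W n))) \<partial>lborel)"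
    unfolding k_def by (rule nn_integral_L[where f = "\<lambda>s. ennreal (log_kern \<alpha> \<rho> \<gamma> \<sigma> (s + ln (W n)))"]) measurable
  also have "\<dots> = (\<integral>\<^sup>+s. ennreal (log_kern \<alpha> \<rho> \<gamma> \<sigma> s) \<partial>lborel)"
    using nn_integral_real_affine[of "\<lambda>y. ennreal (log_kern \<alpha> \<rho> \<gamma> \<sigma> y)" 1 "ln (W n)"] by (simp add: add.commute)
  finally show ?thesis using kernel_params by (simp add: nn_integral_log_kern K_def)
qed

lemma marginal_N: "(\<integral>\<^sup>+n. ennreal (k x n) \<partial>N) \<le> ennreal K"
proof -
  have "(\<integral>\<^sup>+n. ennreal (k x n) \<partial>N) = (\<Sum>n. ennreal (\<nu> (Suc n) / W n) * ennreal (k x n))"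
    unfolding N_def by (simp add: nn_integral_density nn_integral_count_space_nat)
  also have "\<dots> = (\<Sum>n. ennreal ((V_seq \<nu> (Suc n) - V_seq \<nu> n) * (log_kern \<alpha> \<rho> \<gamma> \<sigma> (L x + ln (W n)) / W n)))"
    using mass_pos[THEN less_imp_le] k_nonneg
    by (intro suminf_cong) (simp add: V_seq_Suc k_def flip: ennreal_mult)
  also have "\<dots> \<le> ennreal K"
    unfolding K_def using kernel_params V_nonneg W_bounds nu_pos
    by (intro log_kern_suminf_le) (auto simp: V_seq_Suc)
  finally show ?thesis .
qed

lemma sigma_finite_M: "sigma_finite_measure M"
proof
  let ?A = "range (\<lambda>n::nat. L -` {- real n..real n} \<inter> space M)"
  have "emeasure M (L -` {- real n..real n} \<inter> space M) = emeasure (distr M borel L) {- real n..real n}" for n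
    by (rule emeasure_distr[symmetric]) auto
  then have "emeasure M (L -` {- real n..real n} \<inter> space M) \<noteq> \<infinity>" for n
    by (simp add: distr_L)
  moreover have "\<Union> ?A = space M"
  proof -
    have "\<exists>n::nat. \<bar>L x\<bar> \<le> real n" for x by (rule real_arch_simple)
    then have "\<exists>n::nat. L x \<in> {- real n..real n}" for x by (simp add: abs_le_iff) (metis minus_le_iff)
    then show ?thesis by blast
  qed
  moreover have "?A \<subseteq> sets M" by (auto intro: measurable_sets[OF L_measurable])
  ultimately show "\<exists>A. countable A \<and> A \<subseteq> sets M \<and> \<Union> A = space M \<and> (\<forall>a\<in>A. emeasure M a \<noteq> \<infinity>)"
    by (intro exI[of _ ?A]) auto
qed

lemma sigma_finite_N: "sigma_finite_measure N"
proof
  have "emeasure N {n} = ennreal (\<nu> (Suc n) / W n)" for n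
    unfolding N_def by (subst emeasure_density) (auto simp: nn_integral_count_space_indicator)
  then show "\<exists>A. countable A \<and> A \<subseteq> sets N \<and> \<Union> A = space N \<and> (\<forall>a\<in>A. emeasure N a \<noteq> \<infinity>)"
    by (intro exI[of _ "range (\<lambda>n. {n})"]) (auto simp: N_def)
qed

lemma pair_MN: "pair_sigma_finite M N" and pair_NM: "pair_sigma_finite N M"
  by (simp_all add: pair_sigma_finite.intro sigma_finite_M sigma_finite_N)

lemma sets_N: "sets N = sets (count_space UNIV)"
  by (simp add: N_def)

lemma k_measurable1 [measurable]: "(\<lambda>x. k x n) \<in> borel_measurable M"
  unfolding k_def by measurable

lemma k_measurable_NM: "(\<lambda>(n, x). k x n) \<in> borel_measurable (N \<Otimes>\<^sub>M M)"
proof -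
  have "(\<lambda>(n, x). k x n) \<in> borel_measurable (count_space UNIV \<Otimes>\<^sub>M M)"
    by (rule measurable_pair_measure_countable1) auto
  moreover have "sets (N \<Otimes>\<^sub>M M) = sets (count_space UNIV \<Otimes>\<^sub>M M)"
    by (intro sets_pair_measure_cong sets_N refl)
  ultimately show ?thesis by (subst measurable_cong_sets[OF _ refl])
qed

lemma k_measurable_MN: "case_prod k \<in> borel_measurable (M \<Otimes>\<^sub>M N)"
  using measurable_pair_swap[OF k_measurable_NM] by (simp add: split_def)

lemma qp: "1 < q" "1 / q + 1 / p = 1"
  using conjugate_exponent[OF pq] pq by auto

lemmas schur_MN = schur_test[OF pair_MN pq k_measurable_MN k_nonneg k_le less_imp_le[OF K_pos]
    eq_refl[OF marginal_M] marginal_N]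
  and schur_NM = schur_test[where k = "\<lambda>n x. k x n", OF pair_NM qp k_measurable_NM k_nonneg k_le less_imp_le[OF K_pos]
    marginal_N eq_refl[OF marginal_M]]
  and dual_MN = dual_extremal[OF pair_MN pq k_measurable_MN k_nonneg k_le less_imp_le[OF K_pos]
    eq_refl[OF marginal_M] marginal_N]

lemma integrable_N_iff:
  fixes f :: "nat \<Rightarrow> real"
  shows "integrable N f \<longleftrightarrow> summable (\<lambda>n. \<nu> (Suc n) / W n * \<bar>f n\<bar>)"
proof -
  have "norm (\<nu> (Suc n) / W n * f n) = \<nu> (Suc n) / W n * \<bar>f n\<bar>" for n
    using mass_pos[of n] by (simp only: real_norm_def abs_mult abs_of_pos)
  moreover have "integrable N f \<longleftrightarrow> integrable (count_space UNIV) (\<lambda>n. \<nu> (Suc n) / W n * f n)"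
    unfolding N_def using mass_pos[THEN less_imp_le] by (subst integrable_density) auto
  ultimately show ?thesis by (simp only: integrable_count_space_nat_iff)
qed

lemma integral_N_eq:
  fixes f :: "nat \<Rightarrow> real"
  assumes "integrable N f"
  shows "(\<lambda>n. \<nu> (Suc n) / W n * f n) sums (\<integral>n. f n \<partial>N)"
proof -
  have "integrable (count_space UNIV) (\<lambda>n. \<nu> (Suc n) / W n * f n)"
    using assms unfolding N_def using mass_pos[THEN less_imp_le]
    by (subst (asm) integrable_density) auto
  from sums_integral_count_space_nat[OF this] show ?thesis
    unfolding N_def using mass_pos[THEN less_imp_le] by (subst integral_density) auto
qed

lemma measurable_N: "f \<in> borel_measurable N"
  by (simp add: N_def)

lemma measurable_M_iff: "f \<in> borel_measurable M \<longleftrightarrow> f \<in> borel_measurable (lebesgue_on {0<..})"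
  by (simp add: M_def)

lemma mu_U_nonneg: "AE x in lebesgue_on {0<..}. 0 \<le> \<mu> x / U x"
proof (rule AE_I2)
  fix x :: real assume "x \<in> space (lebesgue_on {0<..})"
  then have "0 < x" by simp
  then show "0 \<le> \<mu> x / U x" using mu_pos U_pos by (simp add: less_imp_le)
qed

lemma integrable_M_iff:
  fixes f :: "real \<Rightarrow> real"
  assumes "f \<in> borel_measurable (lebesgue_on {0<..})"
  shows "integrable M f \<longleftrightarrow> integrable (lebesgue_on {0<..}) (\<lambda>x. \<mu> x / U x * f x)"
  unfolding M_def using assms mu_U_nonneg by (subst integrable_density) auto

lemma integral_M_eq:
  fixes f :: "real \<Rightarrow> real"
  assumes "f \<in> borel_measurable (lebesgue_on {0<..})"
  shows "(\<integral>x. f x \<partial>M) = (\<integral>x. \<mu> x / U x * f x \<partial>lebesgue_on {0<..})"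
  unfolding M_def using assms mu_U_nonneg by (subst integral_density) auto

text \<open>
  The function \<open>\<phi> = exp(\<epsilon>s/p)\<close> on \<open>s \<le> 0\<close> is almost an eigenfunction of the convolution. For
  \<open>y = ln W\<^sub>n \<ge> R\<close> the window \<open>s + y \<in> [-R, R]\<close> lies inside \<open>s \<le> 0\<close>, and there \<open>\<phi>(s) \<ge> exp(-\<epsilon>(R + y)/p)\<close>. The
  losses \<open>e^(-\<epsilon>R)\<close> and \<open>V^(-\<epsilon>)\<close> vanish with \<open>\<epsilon>\<close>; they are collected in the constant \<open>D\<close>.
\<close>
lemma near_extremal:
  assumes c: "0 < c" "c < K"
  obtains \<phi> where "\<phi> \<in> borel_measurable M" "\<And>x. 0 \<le> \<phi> x" "integrable M (\<lambda>x. \<phi> x powr p)"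
    "0 < (\<integral>x. \<phi> x powr p \<partial>M)"
    "c powr p * (\<integral>x. \<phi> x powr p \<partial>M) \<le> (\<integral>n. (\<integral>x. k x n * \<phi> x \<partial>M) powr p \<partial>N)"
proof -
  let ?G = "log_kern \<alpha> \<rho> \<gamma> \<sigma>"
  have G_nonneg: "0 \<le> ?G s" for s using kernel_params by (simp add: log_kern_nonneg)
  have G_int: "integrable lborel ?G"
    using nn_integral_log_kern[of \<alpha> \<rho> \<gamma> \<sigma>] kernel_params G_nonneg by (intro integrableI_nonneg) auto
  have G_total: "(\<integral>s. ?G s \<partial>lborel) = K"
    using nn_integral_log_kern[of \<alpha> \<rho> \<gamma> \<sigma>] kernel_params G_nonneg k_const_nonneg[of \<alpha> \<rho> \<gamma> \<sigma>]
    by (subst integral_eq_nn_integral) (auto simp: K_def)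
  \<comment> \<open>Truncation of the kernel to a compact interval that carries more than \<open>c\<close> of its mass.\<close>
  obtain R where R: "0 \<le> R" "c < (\<integral>s. indicator {-R..R} s * ?G s \<partial>lborel)"
  proof -
    have "(\<lambda>n. \<integral>s. indicator {- real n..real n} s * ?G s \<partial>lborel) \<longlonglongrightarrow> (\<integral>s. ?G s \<partial>lborel)"
    proof (rule integral_dominated_convergence[where w = ?G])
      show "AE s in lborel. (\<lambda>n. indicator {- real n..real n} s * ?G s) \<longlonglongrightarrow> ?G s"
      proof (rule AE_I2, rule tendsto_eventually)
        fix s :: real
        obtain n0 :: nat where "\<bar>s\<bar> \<le> real n0" using real_arch_simple by blast
        then have "indicator {- real n..real n} s * ?G s = ?G s" if "n0 \<le> n" for n
        proof -
          have "real n0 \<le> real n" using that by simp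
          then have "s \<in> {- real n..real n}" using \<open>\<bar>s\<bar> \<le> real n0\<close> unfolding atLeastAtMost_iff by linarith
          then show ?thesis by simp
        qed
        then show "\<forall>\<^sub>F n in sequentially. indicator {- real n..real n} s * ?G s = ?G s"
          by (rule eventually_sequentiallyI)
      qed
      show "AE s in lborel. norm (indicator {- real n..real n} s * ?G s) \<le> ?G s" for n
        by (intro AE_I2) (simp add: indicator_def G_nonneg)
      show "?G \<in> borel_measurable lborel" "(\<lambda>s. indicator {- real n..real n} s * ?G s) \<in> borel_measurable lborel" for n
        by measurable
      show "integrable lborel ?G" by (rule G_int)
    qed
    then have "\<forall>\<^sub>F n in sequentially. c < (\<integral>s. indicator {- real n..real n} s * ?G s \<partial>lborel)"
      by (rule order_tendstoD) (simp add: G_total c)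
    then obtain n where "c < (\<integral>s. indicator {- real n..real n} s * ?G s \<partial>lborel)"
      using eventually_happens'[OF sequentially_bot] by blast
    then show ?thesis by (intro that[of "real n"]) simp_all
  qed
  define J where "J = (\<integral>s. indicator {-R..R} s * ?G s \<partial>lborel)"
  have J: "c < J" "0 < J" using R c by (auto simp: J_def)
  obtain n0 where n0: "\<And>n. n0 \<le> n \<Longrightarrow> exp R \<le> W n" "\<And>n. n0 \<le> n \<Longrightarrow> \<nu> (Suc (Suc n)) \<le> \<nu> (Suc n)"
  proof -
    obtain m where m: "\<And>n. m \<le> n \<Longrightarrow> \<nu> (Suc n) \<le> \<nu> n" using nu_decr by blast
    have "\<forall>\<^sub>F n in sequentially. exp R \<le> W n" using W_at_top by (simp add: filterlim_at_top)
    then obtain m' where "\<And>n. m' \<le> n \<Longrightarrow> exp R \<le> W n" by (auto simp: eventually_sequentially)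
    then show ?thesis using m by (intro that[of "max m m'"]) auto
  qed
  define D where "D = exp R * V_seq \<nu> (Suc n0)"
  have D: "0 < D" using V_pos by (simp add: D_def)
  obtain \<epsilon> where \<epsilon>: "0 < \<epsilon>" "c powr p \<le> J powr p * D powr (- \<epsilon>)"
  proof -
    have "((\<lambda>\<epsilon>. J powr p * D powr (- \<epsilon>)) \<longlongrightarrow> J powr p * D powr (- 0)) (at_right 0)"
      using D by (intro tendsto_intros) auto
    moreover have "c powr p < J powr p * D powr (- 0)"
      using c J D pq by (simp add: powr_less_mono2)
    ultimately have "\<forall>\<^sub>F \<epsilon> in at_right 0. c powr p < J powr p * D powr (- \<epsilon>)"
      by (rule order_tendstoD)
    then have "\<forall>\<^sub>F \<epsilon> in at_right 0. 0 < \<epsilon> \<and> c powr p < J powr p * D powr (- \<epsilon>)"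
      using eventually_at_right_less[of "0::real"] by eventually_elim simp
    then obtain \<epsilon> where "0 < \<epsilon>" "c powr p < J powr p * D powr (- \<epsilon>)"
      using eventually_happens'[OF trivial_limit_at_right_real] by blast
    then show ?thesis by (intro that less_imp_le)
  qed
  define f where "f s = exp (\<epsilon> * s / p) * indicator {..0} s" for s :: real
  define \<phi> where "\<phi> x = f (L x)" for x
  have f_meas [measurable]: "f \<in> borel_measurable borel" unfolding f_def by measurable
  have \<phi>_meas [measurable]: "\<phi> \<in> borel_measurable M" unfolding \<phi>_def by measurable
  have f_nonneg: "0 \<le> f s" for s by (simp add: f_def)
  have \<phi>_nonneg: "0 \<le> \<phi> x" for x by (simp add: \<phi>_def f_nonneg)
  have norm: "(\<integral>\<^sup>+x. ennreal (\<phi> x powr p) \<partial>M) = ennreal (1 / \<epsilon>)"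
  proof -
    have "(\<integral>\<^sup>+x. ennreal (\<phi> x powr p) \<partial>M) = (\<integral>\<^sup>+s. ennreal (f s powr p) \<partial>lborel)"
      unfolding \<phi>_def by (rule nn_integral_L[where f = "\<lambda>s. ennreal (f s powr p)"]) measurable
    also have "\<dots> = (\<integral>\<^sup>+s. ennreal (exp (\<epsilon> * s)) * indicator {..0} s \<partial>lborel)"
      using pq by (intro nn_integral_cong) (auto simp: f_def exp_powr_real split: split_indicator)
    finally show ?thesis using \<epsilon> by (simp add: nn_integral_exp_neg_ray)
  qed
  have \<phi>_int: "integrable M (\<lambda>x. \<phi> x powr p)"
    using norm by (intro integrableI_nonneg) auto
  have \<phi>_norm: "(\<integral>x. \<phi> x powr p \<partial>M) = 1 / \<epsilon>"
    using norm \<epsilon> by (subst integral_eq_nn_integral) auto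
  have \<phi>_abs: "integrable M (\<lambda>x. \<bar>\<phi> x\<bar> powr p)" using \<phi>_int \<phi>_nonneg by simp
  define g where "g n = (\<integral>x. k x n * \<phi> x \<partial>M)" for n
  have g_nonneg: "0 \<le> g n" for n
    unfolding g_def by (intro integral_nonneg_AE AE_I2 mult_nonneg_nonneg k_nonneg \<phi>_nonneg)
  have g_int: "integrable N (\<lambda>n. g n powr p)"
    using schur_MN(2)[OF \<phi>_meas \<phi>_abs] g_nonneg by (simp add: g_def)
  have g_lower: "(J * exp (- (\<epsilon> * R / p))) * W n powr (- (\<epsilon> / p)) \<le> g n" if n: "n0 \<le> n" for n
  proof -
    define y where "y = ln (W n)"
    have y: "R \<le> y" using n0(1)[OF n] W_bounds(3)[of n] by (simp add: y_def ln_ge_iff)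
    have int: "integrable M (\<lambda>x. k x n * \<phi> x)"
      using schur_MN(1)[OF \<phi>_meas \<phi>_abs] by (simp add: N_def)
    have fun_eq: "(\<lambda>x. k x n * \<phi> x) = (\<lambda>x. (\<lambda>s. ?G (s + y) * f s) (L x))"
      by (simp add: k_def \<phi>_def y_def)
    have int': "integrable lborel (\<lambda>s. ?G (s + y) * f s)"
      using int unfolding fun_eq by (subst distr_L[symmetric], subst integrable_distr_eq) auto
    have int2: "integrable lborel (\<lambda>s. indicator {-R..R} s * ?G s)"
      using integrable_mult_indicator[OF _ G_int, of "{-R..R}"] by simp
    have "(J * exp (- (\<epsilon> * R / p))) * W n powr (- (\<epsilon> / p)) = exp (- (\<epsilon> * (R + y) / p)) * J"
      using W_bounds(3)[of n] by (simp add: powr_def y_def exp_add[symmetric] algebra_simps add_divide_distrib)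
    also have "\<dots> = (\<integral>s. exp (- (\<epsilon> * (R + y) / p)) * (indicator {-R..R} (y + 1 * s) * ?G (y + 1 * s)) \<partial>lborel)"
      unfolding J_def using lborel_integral_real_affine[of 1 "\<lambda>s. indicator {-R..R} s * ?G s" y] by simp
    also have "\<dots> \<le> (\<integral>s. ?G (s + y) * f s \<partial>lborel)"
    proof (rule integral_mono[OF _ int'])
      show "integrable lborel (\<lambda>s. exp (- (\<epsilon> * (R + y) / p)) * (indicator {-R..R} (y + 1 * s) * ?G (y + 1 * s)))"
        using lborel_integrable_real_affine[OF int2, of 1 y] by simp
      fix s :: real
      show "exp (- (\<epsilon> * (R + y) / p)) * (indicator {-R..R} (y + 1 * s) * ?G (y + 1 * s)) \<le> ?G (s + y) * f s"
      proof (cases "y + s \<in> {-R..R}")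
        case True
        then have s: "s \<le> 0" "- (R + y) \<le> s" using y by auto
        then have "\<epsilon> * (- (R + y)) \<le> \<epsilon> * s" using \<epsilon> by (intro mult_left_mono) auto
        then have "\<epsilon> * (- (R + y)) / p \<le> \<epsilon> * s / p"
          using pq by (intro divide_right_mono) auto
        moreover have "\<epsilon> * (- (R + y)) / p = - (\<epsilon> * (R + y) / p)" by (simp only: mult_minus_right minus_divide_left)
        ultimately have "- (\<epsilon> * (R + y) / p) \<le> \<epsilon> * s / p" by (simp only:)
        then have "exp (- (\<epsilon> * (R + y) / p)) \<le> f s" using s by (simp add: f_def)
        then have "exp (- (\<epsilon> * (R + y) / p)) * ?G (s + y) \<le> f s * ?G (s + y)"
          using G_nonneg by (rule mult_right_mono)
        then show ?thesis using True by (simp add: ac_simps)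
      qed (simp add: G_nonneg f_nonneg)
    qed
    also have "\<dots> = g n"
      unfolding g_def fun_eq by (subst distr_L[symmetric], subst integral_distr) auto
    finally show ?thesis .
  qed
  have "c powr p * (1 / \<epsilon>) \<le> J powr p * D powr (- \<epsilon>) * (1 / \<epsilon>)"
    using \<epsilon> by (intro mult_right_mono) auto
  also have "\<dots> = (J * exp (- (\<epsilon> * R / p))) powr p * (V_seq \<nu> (Suc n0) powr (- \<epsilon>) / \<epsilon>)"
  proof -
    have "D powr (- \<epsilon>) = exp (- (\<epsilon> * R / p)) powr p * V_seq \<nu> (Suc n0) powr (- \<epsilon>)"
      using V_pos[of n0] pq by (simp add: D_def powr_mult exp_powr_real mult.commute)
    then show ?thesis using J by (simp add: powr_mult)
  qed
  also have "\<dots> \<le> (\<Sum>n. \<nu> (Suc n) / W n * g n powr p)"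
  proof (rule suminf_tail_lower_bound[where V = "\<lambda>n. V_seq \<nu> (Suc n)" and d = "\<lambda>n. \<nu> (Suc n)" and v = W])
    show "filterlim (\<lambda>n. V_seq \<nu> (Suc n)) at_top sequentially"
      by (rule filterlim_compose[OF V_seq_at_top[OF V_inf] filterlim_Suc])
    show "summable (\<lambda>n. \<nu> (Suc n) / W n * g n powr p)"
      using g_int by (simp add: integrable_N_iff)
    show "0 \<le> \<nu> (Suc n) / W n * g n powr p" for n
      by (rule mult_nonneg_nonneg[OF less_imp_le[OF mass_pos] powr_ge_zero])
    fix n assume n: "n0 \<le> n"
    have "((J * exp (- (\<epsilon> * R / p))) * W n powr (- (\<epsilon> / p))) powr p \<le> g n powr p"
      using g_lower[OF n] J pq by (intro powr_mono2) auto
    then have "(J * exp (- (\<epsilon> * R / p))) powr p * W n powr (- \<epsilon>) \<le> g n powr p"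
      using J pq by (simp add: powr_mult powr_powr)
    then have "\<nu> (Suc n) / W n * ((J * exp (- (\<epsilon> * R / p))) powr p * W n powr (- \<epsilon>)) \<le> \<nu> (Suc n) / W n * g n powr p"
      using mass_pos[of n] by (intro mult_left_mono) auto
    moreover have "W n powr (- 1 - \<epsilon>) = W n powr (- \<epsilon>) / W n"
    proof -
      have "W n powr (- 1 - \<epsilon>) = W n powr (- \<epsilon> - 1)" by (rule arg_cong) simp
      then show ?thesis using W_bounds(3)[of n] by (simp add: powr_diff)
    qed
    ultimately show "(J * exp (- (\<epsilon> * R / p))) powr p * (\<nu> (Suc n) * W n powr (- 1 - \<epsilon>)) \<le> \<nu> (Suc n) / W n * g n powr p"
      by (simp add: field_simps)
  qed (use V_pos V_seq_Suc W_bounds nu_pos n0 \<epsilon> in auto)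
  also have "\<dots> = (\<integral>n. g n powr p \<partial>N)"
    using integral_N_eq[OF g_int] by (rule sums_unique[symmetric])
  finally show ?thesis
    using that[OF \<phi>_meas \<phi>_nonneg \<phi>_int] \<epsilon> by (simp add: \<phi>_norm g_def)
qed

section \<open>Translation of the weighted spaces\<close>

abbreviation "H \<equiv> kernel_H \<alpha> \<rho> \<gamma> \<delta> U (V_tilde \<nu> \<nu>t)"
abbreviation "\<Phi> \<equiv> weight_Phi p \<sigma> \<delta> \<mu> U"
abbreviation "\<Psi> \<equiv> weight_Psi q \<sigma> \<nu> (V_tilde \<nu> \<nu>t)"
abbreviation "\<Phi>' \<equiv> \<lambda>x. \<Phi> x powr (1 - q)"
abbreviation "\<Psi>' \<equiv> \<lambda>n. \<Psi> n powr (1 - p)"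

text \<open>The kernel of the operators differs from \<open>k\<close> by the factors that the substitutions for \<open>f\<close>, \<open>a\<close> and for the images supply.\<close>
lemma k_eq:
  assumes "0 < x"
  shows "k x n = H x (Suc n) * (U x powr (\<delta> * \<sigma>) * W n powr \<sigma>)"
proof -
  have "exp (L x + ln (W n)) = U x powr \<delta> * W n"
    using U_pos[OF assms] W_bounds(3)[of n] by (simp add: L_def powr_def exp_add)
  moreover have "exp (\<sigma> * (L x + ln (W n))) = U x powr (\<delta> * \<sigma>) * W n powr \<sigma>"
    using U_pos[OF assms] W_bounds(3)[of n] by (simp add: L_def powr_def exp_add[symmetric] algebra_simps)
  ultimately show ?thesis by (simp add: k_def log_kern_def kern_def kernel_H_def W_def)
qed

lemma U_measurable [measurable]: "U \<in> borel_measurable (lebesgue_on {0<..})"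
  and mu_measurable [measurable]: "\<mu> \<in> borel_measurable (lebesgue_on {0<..})"
proof -
  have "continuous_on {0<..} U"
    by (intro continuous_at_imp_continuous_on) (auto intro: DERIV_isCont U_deriv)
  then show "U \<in> borel_measurable (lebesgue_on {0<..})" "\<mu> \<in> borel_measurable (lebesgue_on {0<..})"
    by (auto intro!: continuous_imp_measurable_on_sets_lebesgue mu_cont)
qed

text \<open>The next four identities say that the substitutions for functions and sequences turn each of the
  four weights into the density of \<open>M\<close> or of \<open>N\<close>.\<close>
lemma Phi_eq: "0 < x \<Longrightarrow> \<Phi> x * (\<mu> x * U x powr (\<delta> * \<sigma> - 1)) powr p = \<mu> x / U x"
proof -
  assume x: "0 < x"
  have e: "p * (1 - \<delta> * \<sigma>) - 1 + (\<delta> * \<sigma> - 1) * p = -1" by (simp add: algebra_simps)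
  have 1: "U x powr (p * (1 - \<delta> * \<sigma>) - 1) * U x powr ((\<delta> * \<sigma> - 1) * p) = U x powr -1"
    by (simp only: powr_add[symmetric] e)
  have 2: "\<mu> x powr p = \<mu> x powr (p - 1) * \<mu> x"
    using mu_pos[OF x] powr_mult_base[of "\<mu> x" "p - 1"] by (simp add: mult.commute)
  have "\<Phi> x * (\<mu> x * U x powr (\<delta> * \<sigma> - 1)) powr p
      = (U x powr (p * (1 - \<delta> * \<sigma>) - 1) * U x powr ((\<delta> * \<sigma> - 1) * p)) * (\<mu> x powr p / \<mu> x powr (p - 1))"
    using mu_pos[OF x] U_pos[OF x] by (simp add: weight_Phi_def powr_mult powr_powr)
  also have "\<dots> = \<mu> x / U x"
    unfolding 1 unfolding 2 using mu_pos[OF x] U_pos[OF x] by (simp add: powr_minus_divide)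
  finally show ?thesis .
qed

lemma Psi_eq: "\<Psi> (Suc n) * (\<nu> (Suc n) * W n powr (\<sigma> - 1)) powr q = \<nu> (Suc n) / W n"
proof -
  note W = W_bounds(3)[of n]
  have nu: "0 < \<nu> (Suc n)" using nu_pos by simp
  have e: "q * (1 - \<sigma>) - 1 + (\<sigma> - 1) * q = -1" by (simp add: algebra_simps)
  have 1: "W n powr (q * (1 - \<sigma>) - 1) * W n powr ((\<sigma> - 1) * q) = W n powr -1"
    by (simp only: powr_add[symmetric] e)
  have 2: "\<nu> (Suc n) powr q = \<nu> (Suc n) powr (q - 1) * \<nu> (Suc n)"
    using nu powr_mult_base[of "\<nu> (Suc n)" "q - 1"] by (simp add: mult.commute)
  have "\<Psi> (Suc n) * (\<nu> (Suc n) * W n powr (\<sigma> - 1)) powr q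
      = (W n powr (q * (1 - \<sigma>) - 1) * W n powr ((\<sigma> - 1) * q)) * (\<nu> (Suc n) powr q / \<nu> (Suc n) powr (q - 1))"
    using nu W by (simp add: weight_Psi_def powr_mult powr_powr flip: W_def)
  also have "\<dots> = \<nu> (Suc n) / W n"
    unfolding 1 unfolding 2 using nu W by (simp add: powr_minus_divide)
  finally show ?thesis .
qed

lemma pq_mult: "(q - 1) * (p - 1) = 1" "p * (q - 1) = q" "q * (p - 1) = p"
proof -
  show 1: "p * (q - 1) = q" "q * (p - 1) = p"
    using conjugate_exponent(2)[OF pq] conjugate_exponent(2)[OF qp] by (simp_all add: mult.commute)
  show "(q - 1) * (p - 1) = 1" using 1 by (simp add: algebra_simps)
qed

lemma Phi'_eq: "0 < x \<Longrightarrow> \<Phi>' x * (U x powr (- (\<delta> * \<sigma>))) powr q = \<mu> x / U x"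
proof -
  assume x: "0 < x"
  note U = U_pos[OF x] and mu = mu_pos[OF x]
  have "\<Phi>' x = U x powr ((p * (1 - \<delta> * \<sigma>) - 1) * (1 - q)) / \<mu> x powr ((p - 1) * (1 - q))"
    using U mu by (simp add: weight_Phi_def powr_divide powr_powr)
  moreover have "(p - 1) * (1 - q) = -1" using pq_mult by (simp add: algebra_simps)
  moreover have "(p * (1 - \<delta> * \<sigma>) - 1) * (1 - q) = \<delta> * \<sigma> * q - 1"
  proof -
    have "(p * (1 - \<delta> * \<sigma>) - 1) * (1 - q) = - (p * (q - 1)) * (1 - \<delta> * \<sigma>) + q - 1"
      by (simp add: algebra_simps)
    also have "\<dots> = \<delta> * \<sigma> * q - 1" unfolding pq_mult by (simp add: algebra_simps)
    finally show ?thesis .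
  qed
  ultimately have "\<Phi>' x = \<mu> x * U x powr (\<delta> * \<sigma> * q - 1)"
    using mu by (simp add: powr_minus_divide)
  then have "\<Phi>' x * (U x powr (- (\<delta> * \<sigma>))) powr q = \<mu> x * (U x powr (\<delta> * \<sigma> * q - 1) * U x powr (- (\<delta> * \<sigma>) * q))"
    by (simp only: powr_powr mult.assoc)
  also have "U x powr (\<delta> * \<sigma> * q - 1) * U x powr (- (\<delta> * \<sigma>) * q) = U x powr -1"
    by (simp flip: powr_add)
  finally show ?thesis using U by (simp add: powr_minus_divide)
qed

lemma Psi'_eq: "\<Psi>' (Suc n) * (W n powr (- \<sigma>)) powr p = \<nu> (Suc n) / W n"
proof -
  note W = W_bounds(3)[of n]
  have nu: "0 < \<nu> (Suc n)" using nu_pos by simp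
  have "\<Psi>' (Suc n) = W n powr ((q * (1 - \<sigma>) - 1) * (1 - p)) / \<nu> (Suc n) powr ((q - 1) * (1 - p))"
    using nu W by (simp add: weight_Psi_def powr_divide powr_powr flip: W_def)
  moreover have "(q - 1) * (1 - p) = -1" using pq_mult by (simp add: algebra_simps)
  moreover have "(q * (1 - \<sigma>) - 1) * (1 - p) = \<sigma> * p - 1"
  proof -
    have "(q * (1 - \<sigma>) - 1) * (1 - p) = - (q * (p - 1)) * (1 - \<sigma>) + p - 1"
      by (simp add: algebra_simps)
    also have "\<dots> = \<sigma> * p - 1" unfolding pq_mult by (simp add: algebra_simps)
    finally show ?thesis .
  qed
  ultimately have "\<Psi>' (Suc n) = \<nu> (Suc n) * W n powr (\<sigma> * p - 1)"
    using nu by (simp add: powr_minus_divide)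
  then have "\<Psi>' (Suc n) * (W n powr (- \<sigma>)) powr p = \<nu> (Suc n) * (W n powr (\<sigma> * p - 1) * W n powr (- \<sigma> * p))"
    by (simp only: powr_powr mult.assoc)
  also have "W n powr (\<sigma> * p - 1) * W n powr (- \<sigma> * p) = W n powr -1"
    by (simp flip: powr_add)
  finally show ?thesis using W by (simp add: powr_minus_divide)
qed

lemma
  assumes f: "\<And>x. 0 < x \<Longrightarrow> f x = \<mu> x * U x powr (\<delta> * \<sigma> - 1) * \<phi> x"
    and \<phi> [measurable]: "\<phi> \<in> borel_measurable M"
  shows wLp_Phi_iff: "f \<in> wLp p \<Phi> \<longleftrightarrow> integrable M (\<lambda>x. \<bar>\<phi> x\<bar> powr p)"
    and wLp_norm_Phi: "wLp_norm p \<Phi> f = (\<integral>x. \<bar>\<phi> x\<bar> powr p \<partial>M) powr (1 / p)"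
    and integrable_H_f: "integrable (lebesgue_on {0<..}) (\<lambda>x. H x (Suc n) * f x) \<longleftrightarrow> integrable M (\<lambda>x. k x n * \<phi> x)"
    and T1_eq: "T1 H f (Suc n) = W n powr (- \<sigma>) * (\<integral>x. k x n * \<phi> x \<partial>M)"
proof -
  have [measurable]: "\<phi> \<in> borel_measurable (lebesgue_on {0<..})" using \<phi> by (simp add: measurable_M_iff)
  have f_meas: "f \<in> borel_measurable (lebesgue_on {0<..})"
  proof -
    have "(\<lambda>x. \<mu> x * U x powr (\<delta> * \<sigma> - 1) * \<phi> x) \<in> borel_measurable (lebesgue_on {0<..})"
      by measurable
    then show ?thesis by (rule measurable_cong[THEN iffD1, rotated]) (simp add: f)
  qed
  have weight: "\<Phi> x * \<bar>f x\<bar> powr p = \<mu> x / U x * \<bar>\<phi> x\<bar> powr p" if "x \<in> space (lebesgue_on {0<..})" for x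
  proof -
    have x: "0 < x" using that by simp
    have "\<bar>f x\<bar> = (\<mu> x * U x powr (\<delta> * \<sigma> - 1)) * \<bar>\<phi> x\<bar>"
      using mu_pos[OF x] by (simp add: f[OF x] abs_mult)
    then have "\<bar>f x\<bar> powr p = (\<mu> x * U x powr (\<delta> * \<sigma> - 1)) powr p * \<bar>\<phi> x\<bar> powr p"
      using mu_pos[OF x] by (simp add: powr_mult)
    then show ?thesis by (simp add: Phi_eq[OF x, symmetric])
  qed
  have kernel: "H x (Suc n) * f x = W n powr (- \<sigma>) * (\<mu> x / U x * (k x n * \<phi> x))" if "x \<in> space (lebesgue_on {0<..})" for x
  proof -
    have x: "0 < x" using that by simp
    show ?thesis
      using U_pos[OF x] W_bounds(3)[of n] by (simp add: f[OF x] k_eq[OF x] powr_diff powr_minus field_simps)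
  qed
  have [measurable]: "(\<lambda>x. k x n) \<in> borel_measurable (lebesgue_on {0<..})"
    using k_measurable1[of n] by (simp add: measurable_M_iff)
  have "f \<in> wLp p \<Phi> \<longleftrightarrow> integrable (lebesgue_on {0<..}) (\<lambda>x. \<Phi> x * \<bar>f x\<bar> powr p)"
    using f_meas by (simp add: wLp_def)
  also have "\<dots> \<longleftrightarrow> integrable (lebesgue_on {0<..}) (\<lambda>x. \<mu> x / U x * \<bar>\<phi> x\<bar> powr p)"
    by (rule Bochner_Integration.integrable_cong[OF refl weight])
  also have "\<dots> \<longleftrightarrow> integrable M (\<lambda>x. \<bar>\<phi> x\<bar> powr p)"
    by (rule integrable_M_iff[symmetric]) measurable
  finally show "f \<in> wLp p \<Phi> \<longleftrightarrow> integrable M (\<lambda>x. \<bar>\<phi> x\<bar> powr p)" .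
  have "(\<integral>x. \<Phi> x * \<bar>f x\<bar> powr p \<partial>lebesgue_on {0<..}) = (\<integral>x. \<mu> x / U x * \<bar>\<phi> x\<bar> powr p \<partial>lebesgue_on {0<..})"
    by (rule Bochner_Integration.integral_cong[OF refl weight])
  also have "\<dots> = (\<integral>x. \<bar>\<phi> x\<bar> powr p \<partial>M)"
    by (rule integral_M_eq[symmetric]) measurable
  finally show "wLp_norm p \<Phi> f = (\<integral>x. \<bar>\<phi> x\<bar> powr p \<partial>M) powr (1 / p)" by (simp add: wLp_norm_def)
  have "integrable (lebesgue_on {0<..}) (\<lambda>x. H x (Suc n) * f x)
      \<longleftrightarrow> integrable (lebesgue_on {0<..}) (\<lambda>x. W n powr (- \<sigma>) * (\<mu> x / U x * (k x n * \<phi> x)))"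
    by (rule Bochner_Integration.integrable_cong[OF refl kernel])
  also have "\<dots> \<longleftrightarrow> integrable (lebesgue_on {0<..}) (\<lambda>x. \<mu> x / U x * (k x n * \<phi> x))"
    using W_bounds(3)[of n] by (subst integrable_mult_left_iff) simp
  also have "\<dots> \<longleftrightarrow> integrable M (\<lambda>x. k x n * \<phi> x)"
    by (rule integrable_M_iff[symmetric]) measurable
  finally show "integrable (lebesgue_on {0<..}) (\<lambda>x. H x (Suc n) * f x) \<longleftrightarrow> integrable M (\<lambda>x. k x n * \<phi> x)" .
  have "T1 H f (Suc n) = (\<integral>x. W n powr (- \<sigma>) * (\<mu> x / U x * (k x n * \<phi> x)) \<partial>lebesgue_on {0<..})"
    unfolding T1_def by (rule Bochner_Integration.integral_cong[OF refl kernel])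
  also have "\<dots> = W n powr (- \<sigma>) * (\<integral>x. \<mu> x / U x * (k x n * \<phi> x) \<partial>lebesgue_on {0<..})"
    by (rule integral_mult_right_zero)
  also have "(\<integral>x. \<mu> x / U x * (k x n * \<phi> x) \<partial>lebesgue_on {0<..}) = (\<integral>x. k x n * \<phi> x \<partial>M)"
    by (rule integral_M_eq[symmetric]) measurable
  finally show "T1 H f (Suc n) = W n powr (- \<sigma>) * (\<integral>x. k x n * \<phi> x \<partial>M)" .
qed

lemma
  assumes g: "\<And>n. c (Suc n) = W n powr (- \<sigma>) * g n"
    and int: "integrable N (\<lambda>n. \<bar>g n\<bar> powr p)"
  shows wlp_Psi': "c \<in> wlp p \<Psi>'"
    and wlp_norm_Psi': "wlp_norm p \<Psi>' c = (\<integral>n. \<bar>g n\<bar> powr p \<partial>N) powr (1 / p)"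
proof -
  have "\<Psi>' (Suc n) * \<bar>c (Suc n)\<bar> powr p = \<nu> (Suc n) / W n * \<bar>g n\<bar> powr p" for n
  proof -
    have "\<bar>c (Suc n)\<bar> powr p = (W n powr (- \<sigma>)) powr p * \<bar>g n\<bar> powr p"
      by (simp add: g abs_mult powr_mult)
    then show ?thesis by (simp add: Psi'_eq[symmetric])
  qed
  then have sums: "(\<lambda>n. \<Psi>' (Suc n) * \<bar>c (Suc n)\<bar> powr p) sums (\<integral>n. \<bar>g n\<bar> powr p \<partial>N)"
    using integral_N_eq[OF int] by simp
  show "c \<in> wlp p \<Psi>'" using sums_summable[OF sums] by (simp add: wlp_def)
  show "wlp_norm p \<Psi>' c = (\<integral>n. \<bar>g n\<bar> powr p \<partial>N) powr (1 / p)"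
    using sums_unique[OF sums] by (simp add: wlp_norm_def)
qed

lemma
  assumes a: "\<And>n. a (Suc n) = \<nu> (Suc n) * W n powr (\<sigma> - 1) * b n"
  shows wlp_Psi_iff: "a \<in> wlp q \<Psi> \<longleftrightarrow> integrable N (\<lambda>n. \<bar>b n\<bar> powr q)"
    and wlp_norm_Psi: "integrable N (\<lambda>n. \<bar>b n\<bar> powr q) \<Longrightarrow> wlp_norm q \<Psi> a = (\<integral>n. \<bar>b n\<bar> powr q \<partial>N) powr (1 / q)"
    and T2_sums: "\<And>x. 0 < x \<Longrightarrow> integrable N (\<lambda>n. k x n * b n) \<Longrightarrow>
       (\<lambda>n. H x (Suc n) * a (Suc n)) sums (U x powr (- (\<delta> * \<sigma>)) * (\<integral>n. k x n * b n \<partial>N))"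
proof -
  have weight: "\<Psi> (Suc n) * \<bar>a (Suc n)\<bar> powr q = \<nu> (Suc n) / W n * \<bar>b n\<bar> powr q" for n
  proof -
    have nu: "0 < \<nu> (Suc n)" using nu_pos by simp
    then have "\<bar>a (Suc n)\<bar> = (\<nu> (Suc n) * W n powr (\<sigma> - 1)) * \<bar>b n\<bar>"
      by (simp add: a abs_mult)
    then have "\<bar>a (Suc n)\<bar> powr q = (\<nu> (Suc n) * W n powr (\<sigma> - 1)) powr q * \<bar>b n\<bar> powr q"
      using nu by (simp add: powr_mult)
    then show ?thesis by (simp add: Psi_eq[symmetric])
  qed
  show "a \<in> wlp q \<Psi> \<longleftrightarrow> integrable N (\<lambda>n. \<bar>b n\<bar> powr q)"
    by (simp add: wlp_def weight integrable_N_iff)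
  show "wlp_norm q \<Psi> a = (\<integral>n. \<bar>b n\<bar> powr q \<partial>N) powr (1 / q)" if "integrable N (\<lambda>n. \<bar>b n\<bar> powr q)"
    using sums_unique[OF integral_N_eq[OF that]] by (simp only: wlp_norm_def weight)
  fix x :: real assume x: "0 < x" and int: "integrable N (\<lambda>n. k x n * b n)"
  have "(\<lambda>n. U x powr (- (\<delta> * \<sigma>)) * (\<nu> (Suc n) / W n * (k x n * b n))) sums (U x powr (- (\<delta> * \<sigma>)) * (\<integral>n. k x n * b n \<partial>N))"
    by (rule sums_mult[OF integral_N_eq[OF int]])
  moreover have "U x powr (- (\<delta> * \<sigma>)) * (\<nu> (Suc n) / W n * (k x n * b n)) = H x (Suc n) * a (Suc n)" for n
    using U_pos[OF x] W_bounds(3)[of n] by (simp add: a k_eq[OF x] powr_diff powr_minus field_simps)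
  ultimately show "(\<lambda>n. H x (Suc n) * a (Suc n)) sums (U x powr (- (\<delta> * \<sigma>)) * (\<integral>n. k x n * b n \<partial>N))"
    by simp
qed

lemma
  assumes h: "\<And>x. 0 < x \<Longrightarrow> F x = U x powr (- (\<delta> * \<sigma>)) * h x"
    and [measurable]: "h \<in> borel_measurable M"
    and int: "integrable M (\<lambda>x. \<bar>h x\<bar> powr q)"
  shows wLp_Phi': "F \<in> wLp q \<Phi>'"
    and wLp_norm_Phi': "wLp_norm q \<Phi>' F = (\<integral>x. \<bar>h x\<bar> powr q \<partial>M) powr (1 / q)"
proof -
  have [measurable]: "h \<in> borel_measurable (lebesgue_on {0<..})" using assms(2) by (simp add: measurable_M_iff)
  have F_meas: "F \<in> borel_measurable (lebesgue_on {0<..})"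
  proof -
    have "(\<lambda>x. U x powr (- (\<delta> * \<sigma>)) * h x) \<in> borel_measurable (lebesgue_on {0<..})"
      by measurable
    then show ?thesis by (rule measurable_cong[THEN iffD1, rotated]) (simp add: h)
  qed
  have weight: "\<Phi>' x * \<bar>F x\<bar> powr q = \<mu> x / U x * \<bar>h x\<bar> powr q" if "x \<in> space (lebesgue_on {0<..})" for x
  proof -
    have x: "0 < x" using that by simp
    have "\<bar>F x\<bar> powr q = (U x powr (- (\<delta> * \<sigma>))) powr q * \<bar>h x\<bar> powr q"
      by (simp add: h[OF x] abs_mult powr_mult)
    then show ?thesis by (simp add: Phi'_eq[OF x, symmetric])
  qed
  have "integrable (lebesgue_on {0<..}) (\<lambda>x. \<Phi>' x * \<bar>F x\<bar> powr q)
      \<longleftrightarrow> integrable (lebesgue_on {0<..}) (\<lambda>x. \<mu> x / U x * \<bar>h x\<bar> powr q)"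
    by (rule Bochner_Integration.integrable_cong[OF refl weight])
  also have "\<dots> \<longleftrightarrow> integrable M (\<lambda>x. \<bar>h x\<bar> powr q)"
    by (rule integrable_M_iff[symmetric]) measurable
  finally show "F \<in> wLp q \<Phi>'" using int F_meas by (simp add: wLp_def)
  have "(\<integral>x. \<Phi>' x * \<bar>F x\<bar> powr q \<partial>lebesgue_on {0<..}) = (\<integral>x. \<mu> x / U x * \<bar>h x\<bar> powr q \<partial>lebesgue_on {0<..})"
    by (rule Bochner_Integration.integral_cong[OF refl weight])
  also have "\<dots> = (\<integral>x. \<bar>h x\<bar> powr q \<partial>M)"
    by (rule integral_M_eq[symmetric]) measurable
  finally show "wLp_norm q \<Phi>' F = (\<integral>x. \<bar>h x\<bar> powr q \<partial>M) powr (1 / q)" by (simp add: wLp_norm_def)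
qed

section \<open>The operator norms\<close>

lemma T1_bounded:
  assumes f: "f \<in> wLp p \<Phi>"
  shows "\<And>n. integrable (lebesgue_on {0<..}) (\<lambda>x. H x (Suc n) * f x)"
    and "T1 H f \<in> wlp p \<Psi>'"
    and "wlp_norm p \<Psi>' (T1 H f) \<le> K * wLp_norm p \<Phi> f"
proof -
  define \<phi> where "\<phi> x = f x / (\<mu> x * U x powr (\<delta> * \<sigma> - 1))" for x
  have f_eq: "f x = \<mu> x * U x powr (\<delta> * \<sigma> - 1) * \<phi> x" if "0 < x" for x
    using mu_pos[OF that] U_pos[OF that] by (simp add: \<phi>_def)
  have [measurable]: "f \<in> borel_measurable (lebesgue_on {0<..})" using f by (simp add: wLp_def)
  have \<phi>: "\<phi> \<in> borel_measurable M"
    unfolding \<phi>_def measurable_M_iff by measurable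
  have int: "integrable M (\<lambda>x. \<bar>\<phi> x\<bar> powr p)" using f wLp_Phi_iff[OF f_eq \<phi>] by simp
  note S = schur_MN[OF \<phi> int]
  show "integrable (lebesgue_on {0<..}) (\<lambda>x. H x (Suc n) * f x)" for n
    using integrable_H_f[OF f_eq \<phi>] S(1)[of n] by (simp add: N_def)
  note T1 = T1_eq[OF f_eq \<phi>]
  show "T1 H f \<in> wlp p \<Psi>'" by (rule wlp_Psi'[OF T1 S(2)])
  have "wlp_norm p \<Psi>' (T1 H f) = (\<integral>n. \<bar>\<integral>x. k x n * \<phi> x \<partial>M\<bar> powr p \<partial>N) powr (1 / p)"
    by (rule wlp_norm_Psi'[OF T1 S(2)])
  also have "\<dots> \<le> (K powr p * (\<integral>x. \<bar>\<phi> x\<bar> powr p \<partial>M)) powr (1 / p)"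
    using pq by (intro powr_mono2 S(3) integral_nonneg_AE) auto
  also have "\<dots> = K * wLp_norm p \<Phi> f"
    using K_pos pq by (simp add: wLp_norm_Phi[OF f_eq \<phi>] powr_mult powr_powr)
  finally show "wlp_norm p \<Psi>' (T1 H f) \<le> K * wLp_norm p \<Phi> f" .
qed

lemma k_integral_measurable: "(\<lambda>x. \<integral>n. k x n * b n \<partial>N) \<in> borel_measurable M"
proof -
  interpret N: sigma_finite_measure N by (rule sigma_finite_N)
  note k_measurable_MN [measurable] and measurable_N [measurable]
  have "(\<lambda>(x, n). k x n * b n) \<in> borel_measurable (M \<Otimes>\<^sub>M N)" by measurable
  then show ?thesis by (rule N.borel_measurable_lebesgue_integral)
qed

lemma T2_bounded:
  assumes a: "a \<in> wlp q \<Psi>"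
  shows "\<And>x. 0 < x \<Longrightarrow> summable (\<lambda>n. H x (Suc n) * a (Suc n))"
    and "T2 H a \<in> wLp q \<Phi>'"
    and "wLp_norm q \<Phi>' (T2 H a) \<le> K * wlp_norm q \<Psi> a"
proof -
  define b where "b n = a (Suc n) / (\<nu> (Suc n) * W n powr (\<sigma> - 1))" for n
  have a_eq: "a (Suc n) = \<nu> (Suc n) * W n powr (\<sigma> - 1) * b n" for n
    using nu_pos[of "Suc n"] W_bounds(3)[of n] by (simp add: b_def)
  have int: "integrable N (\<lambda>n. \<bar>b n\<bar> powr q)" using a wlp_Psi_iff[OF a_eq] by simp
  note S = schur_NM[OF measurable_N int]
  have sums: "(\<lambda>n. H x (Suc n) * a (Suc n)) sums (U x powr (- (\<delta> * \<sigma>)) * (\<integral>n. k x n * b n \<partial>N))" if "0 < x" for x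
    using T2_sums[OF a_eq that] S(1)[of x] that by (simp add: space_M)
  show "summable (\<lambda>n. H x (Suc n) * a (Suc n))" if "0 < x" for x
    using sums[OF that] by (rule sums_summable)
  have T2: "T2 H a x = U x powr (- (\<delta> * \<sigma>)) * (\<integral>n. k x n * b n \<partial>N)" if "0 < x" for x
    unfolding T2_def using sums[OF that] by (rule sums_unique[symmetric])
  show "T2 H a \<in> wLp q \<Phi>'" by (rule wLp_Phi'[OF T2 k_integral_measurable S(2)])
  have "wLp_norm q \<Phi>' (T2 H a) = (\<integral>x. \<bar>\<integral>n. k x n * b n \<partial>N\<bar> powr q \<partial>M) powr (1 / q)"
    by (rule wLp_norm_Phi'[OF T2 k_integral_measurable S(2)])
  also have "\<dots> \<le> (K powr q * (\<integral>n. \<bar>b n\<bar> powr q \<partial>N)) powr (1 / q)"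
    using qp by (intro powr_mono2 S(3) integral_nonneg_AE) auto
  also have "\<dots> = K * wlp_norm q \<Psi> a"
    using K_pos qp by (simp add: wlp_norm_Psi[OF a_eq int] powr_mult powr_powr)
  finally show "wLp_norm q \<Phi>' (T2 H a) \<le> K * wlp_norm q \<Psi> a" .
qed

lemma T1_near_extremal:
  assumes c: "0 < c" "c < K"
  obtains f where "f \<in> wLp p \<Phi>" "\<not> (AE x in lebesgue_on {0<..}. f x = 0)"
    "c \<le> wlp_norm p \<Psi>' (T1 H f) / wLp_norm p \<Phi> f"
proof -
  obtain \<phi> where \<phi>: "\<phi> \<in> borel_measurable M" "\<And>x. 0 \<le> \<phi> x" "integrable M (\<lambda>x. \<phi> x powr p)"
    "0 < (\<integral>x. \<phi> x powr p \<partial>M)"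
    "c powr p * (\<integral>x. \<phi> x powr p \<partial>M) \<le> (\<integral>n. (\<integral>x. k x n * \<phi> x \<partial>M) powr p \<partial>N)"
    by (rule near_extremal[OF c]) blast
  define A where "A = (\<integral>x. \<phi> x powr p \<partial>M)"
  have int: "integrable M (\<lambda>x. \<bar>\<phi> x\<bar> powr p)" using \<phi>(2,3) by simp
  define f where "f x = \<mu> x * U x powr (\<delta> * \<sigma> - 1) * \<phi> x" for x
  have f: "f \<in> wLp p \<Phi>" using wLp_Phi_iff[OF f_def \<phi>(1)] int by simp
  have norm_f: "wLp_norm p \<Phi> f = A powr (1 / p)"
    using wLp_norm_Phi[OF f_def \<phi>(1)] \<phi>(2) by (simp add: A_def)
  have norm_Tf: "wlp_norm p \<Psi>' (T1 H f) = (\<integral>n. (\<integral>x. k x n * \<phi> x \<partial>M) powr p \<partial>N) powr (1 / p)"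
  proof -
    have "0 \<le> (\<integral>x. k x n * \<phi> x \<partial>M)" for n
      by (intro integral_nonneg_AE AE_I2 mult_nonneg_nonneg k_nonneg \<phi>(2))
    then show ?thesis using wlp_norm_Psi'[OF T1_eq[OF f_def \<phi>(1)] schur_MN(2)[OF \<phi>(1) int]] by simp
  qed
  have "c * A powr (1 / p) = (c powr p * A) powr (1 / p)"
    using c pq \<phi>(4) by (simp add: powr_mult powr_powr A_def)
  also have "\<dots> \<le> wlp_norm p \<Psi>' (T1 H f)"
    unfolding norm_Tf using \<phi>(4,5) pq by (intro powr_mono2) (auto simp: A_def)
  finally have "c \<le> wlp_norm p \<Psi>' (T1 H f) / wLp_norm p \<Phi> f"
    using \<phi>(4) by (simp add: norm_f A_def pos_le_divide_eq)
  moreover have "\<not> (AE x in lebesgue_on {0<..}. f x = 0)"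
  proof
    assume "AE x in lebesgue_on {0<..}. f x = 0"
    then have "(\<integral>x. \<Phi> x * \<bar>f x\<bar> powr p \<partial>lebesgue_on {0<..}) = 0"
      using pq by (intro integral_eq_zero_AE) auto
    then have "wLp_norm p \<Phi> f = 0" by (simp add: wLp_norm_def)
    then show False using norm_f \<phi>(4) by (simp add: A_def)
  qed
  ultimately show ?thesis using that f by blast
qed

text \<open>With \<open>A = \<integral> \<phi>^p\<close> and \<open>S = \<integral> g^p\<close>, duality gives a quotient of at least
  \<open>S / (A^(1/p) S^(1/q)) = (S/A)^(1/p)\<close>, which is the quotient that \<open>\<phi>\<close> achieves for \<open>T1\<close>.\<close>
lemma T2_near_extremal:
  assumes c: "0 < c" "c < K"
  obtains a where "a \<in> wlp q \<Psi>" "\<exists>n\<ge>1. a n \<noteq> 0"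
    "c \<le> wLp_norm q \<Phi>' (T2 H a) / wlp_norm q \<Psi> a"
proof -
  obtain \<phi> where \<phi>: "\<phi> \<in> borel_measurable M" "\<And>x. 0 \<le> \<phi> x" "integrable M (\<lambda>x. \<phi> x powr p)"
    "0 < (\<integral>x. \<phi> x powr p \<partial>M)"
    "c powr p * (\<integral>x. \<phi> x powr p \<partial>M) \<le> (\<integral>n. (\<integral>x. k x n * \<phi> x \<partial>M) powr p \<partial>N)"
    by (rule near_extremal[OF c]) blast
  define A where "A = (\<integral>x. \<phi> x powr p \<partial>M)"
  define S where "S = (\<integral>n. (\<integral>x. k x n * \<phi> x \<partial>M) powr p \<partial>N)"
  have A: "0 < A" and AS: "c powr p * A \<le> S" using \<phi>(4,5) by (auto simp: A_def S_def)
  have S: "0 < S" using AS A c by (intro less_le_trans[OF _ AS]) simp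
  define b where "b n = (\<integral>x. k x n * \<phi> x \<partial>M) powr (p - 1)" for n
  note dual = dual_MN[OF \<phi>(1-3), folded b_def]
  define Q where "Q = (\<integral>x. \<bar>\<integral>n. k x n * b n \<partial>N\<bar> powr q \<partial>M)"
  define a where "a n = (if n = 0 then 0 else \<nu> n * W (n - 1) powr (\<sigma> - 1) * b (n - 1))" for n
  have a_eq: "a (Suc n) = \<nu> (Suc n) * W n powr (\<sigma> - 1) * b n" for n by (simp add: a_def)
  have a: "a \<in> wlp q \<Psi>" using wlp_Psi_iff[OF a_eq] dual(2) by simp
  have norm_a: "wlp_norm q \<Psi> a = S powr (1 / q)"
    using wlp_norm_Psi[OF a_eq dual(2)] dual(3) by (simp add: S_def)
  have norm_Ta: "wLp_norm q \<Phi>' (T2 H a) = Q powr (1 / q)"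
  proof -
    note NM = schur_NM[OF measurable_N dual(2)]
    have "T2 H a x = U x powr (- (\<delta> * \<sigma>)) * (\<integral>n. k x n * b n \<partial>N)" if "0 < x" for x
      unfolding T2_def using T2_sums[OF a_eq that] NM(1)[of x] that
      by (intro sums_unique[symmetric]) (simp add: space_M)
    from wLp_norm_Phi'[OF this k_integral_measurable NM(2)] show ?thesis by (simp add: Q_def)
  qed
  have "c * S powr (1 / q) * A powr (1 / p) = (c powr p * A) powr (1 / p) * S powr (1 / q)"
    using c pq A by (simp add: powr_mult powr_powr)
  also have "\<dots> \<le> S powr (1 / p) * S powr (1 / q)"
    using AS A c pq by (intro mult_right_mono powr_mono2) auto
  also have "\<dots> = S" using S pq by (simp flip: powr_add)
  also have "\<dots> \<le> A powr (1 / p) * Q powr (1 / q)"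
    using dual(4) by (simp add: S_def A_def Q_def)
  finally have "A powr (1 / p) * (c * S powr (1 / q)) \<le> A powr (1 / p) * Q powr (1 / q)"
    by (simp add: ac_simps)
  then have "c * S powr (1 / q) \<le> Q powr (1 / q)"
    using A by (subst (asm) mult_le_cancel_left_pos) auto
  then have "c \<le> wLp_norm q \<Phi>' (T2 H a) / wlp_norm q \<Psi> a"
    using S by (simp add: norm_a norm_Ta pos_le_divide_eq)
  moreover have "\<exists>n\<ge>1. a n \<noteq> 0"
  proof (rule ccontr)
    assume "\<not> (\<exists>n\<ge>1. a n \<noteq> 0)"
    then have "a (Suc n) = 0" for n by simp
    then have "wlp_norm q \<Psi> a = 0" using qp by (simp add: wlp_norm_def)
    then show False using norm_a S by simp
  qed
  ultimately show ?thesis using that a by blast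
qed

lemma T1_norm_eq: "T1_norm p \<Phi> \<Psi>' H = ereal K"
proof (rule antisym)
  show "T1_norm p \<Phi> \<Psi>' H \<le> ereal K"
    unfolding T1_norm_def
  proof (rule SUP_least)
    fix f assume "f \<in> {f \<in> wLp p \<Phi>. \<not> (AE x in lebesgue_on {0<..}. f x = 0)}"
    then have "wlp_norm p \<Psi>' (T1 H f) \<le> K * wLp_norm p \<Phi> f" using T1_bounded(3) by blast
    moreover have "0 \<le> wLp_norm p \<Phi> f" by (simp add: wLp_norm_def)
    ultimately show "ereal (wlp_norm p \<Psi>' (T1 H f) / wLp_norm p \<Phi> f) \<le> ereal K"
      using K_pos by (cases "wLp_norm p \<Phi> f = 0") (auto simp: pos_divide_le_eq)
  qed
  show "ereal K \<le> T1_norm p \<Phi> \<Psi>' H"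
  proof (rule ereal_le_by_density[OF K_pos])
    fix c assume "0 < c" "c < K"
    then obtain f where "f \<in> wLp p \<Phi>" "\<not> (AE x in lebesgue_on {0<..}. f x = 0)"
      "c \<le> wlp_norm p \<Psi>' (T1 H f) / wLp_norm p \<Phi> f" by (rule T1_near_extremal)
    then show "ereal c \<le> T1_norm p \<Phi> \<Psi>' H"
      unfolding T1_norm_def by (intro SUP_upper2[of f]) auto
  qed
qed

lemma T2_norm_eq: "T2_norm q \<Psi> \<Phi>' H = ereal K"
proof (rule antisym)
  show "T2_norm q \<Psi> \<Phi>' H \<le> ereal K"
    unfolding T2_norm_def
  proof (rule SUP_least)
    fix a assume "a \<in> {a \<in> wlp q \<Psi>. \<exists>n\<ge>1. a n \<noteq> 0}"
    then have "wLp_norm q \<Phi>' (T2 H a) \<le> K * wlp_norm q \<Psi> a" using T2_bounded(3) by blast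
    moreover have "0 \<le> wlp_norm q \<Psi> a" by (simp add: wlp_norm_def)
    ultimately show "ereal (wLp_norm q \<Phi>' (T2 H a) / wlp_norm q \<Psi> a) \<le> ereal K"
      using K_pos by (cases "wlp_norm q \<Psi> a = 0") (auto simp: pos_divide_le_eq)
  qed
  show "ereal K \<le> T2_norm q \<Psi> \<Phi>' H"
  proof (rule ereal_le_by_density[OF K_pos])
    fix c assume "0 < c" "c < K"
    then obtain a where "a \<in> wlp q \<Psi>" "\<exists>n\<ge>1. a n \<noteq> 0"
      "c \<le> wLp_norm q \<Phi>' (T2 H a) / wlp_norm q \<Psi> a" by (rule T2_near_extremal)
    then show "ereal c \<le> T2_norm q \<Psi> \<Phi>' H"
      unfolding T2_norm_def by (intro SUP_upper2[of a]) auto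
  qed
qed

end

theorem mainTheorem3:
  fixes \<alpha> \<rho> \<gamma> \<sigma> \<delta> p q :: real
    and \<mu> :: "real \<Rightarrow> real"
    and \<nu> \<nu>t :: "nat \<Rightarrow> real"
  assumes "0 \<le> \<alpha>" "\<alpha> \<le> \<rho>" "0 < \<rho>"
    and "0 < \<gamma>" "\<gamma> < \<sigma>" "\<sigma> \<le> 1"
    and "\<delta> \<in> {-1, 1}"
    and "1 < p" "1 / p + 1 / q = 1"
    and nu_pos: "\<And>n. 1 \<le> n \<Longrightarrow> 0 < \<nu> n"
    and nut: "\<And>n. 1 \<le> n \<Longrightarrow> \<nu>t n \<in> {0 .. \<nu> n / 2}"
    and mu_pos: "\<And>x. 0 < x \<Longrightarrow> 0 < \<mu> x"
    and mu_cont: "continuous_on {0<..} \<mu>"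
    and U_finite: "\<And>x. 0 \<le> x \<Longrightarrow> set_integrable lborel {0<..x} \<mu>"
    and nu_decr: "\<exists>n0\<ge>1. \<forall>n\<ge>n0. \<nu> (Suc n) \<le> \<nu> n"
    and U_inf: "U_infinity \<mu> = \<infinity>"
    and V_inf: "filterlim (V_fun \<nu>) at_top at_top"
  shows "let U = U_fun \<mu>; W = V_tilde \<nu> \<nu>t;
             H = kernel_H \<alpha> \<rho> \<gamma> \<delta> U W;
             \<Phi> = weight_Phi p \<sigma> \<delta> \<mu> U; \<Psi> = weight_Psi q \<sigma> \<nu> W;
             \<Phi>' = (\<lambda>x. \<Phi> x powr (1 - q)); \<Psi>' = (\<lambda>n. \<Psi> n powr (1 - p))
         in (\<forall>f \<in> wLp p \<Phi>.
               (\<forall>n\<ge>1. integrable (lebesgue_on {0<..}) (\<lambda>x. H x n * f x)) \<and> T1 H f \<in> wlp p \<Psi>')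
          \<and> (\<forall>a \<in> wlp q \<Psi>.
               (\<forall>x>0. summable (\<lambda>n. H x (Suc n) * a (Suc n))) \<and> T2 H a \<in> wLp q \<Phi>')
          \<and> T1_norm p \<Phi> \<Psi>' H = ereal (k_const \<alpha> \<rho> \<gamma> \<sigma>)
          \<and> T2_norm q \<Psi> \<Phi>' H = ereal (k_const \<alpha> \<rho> \<gamma> \<sigma>)
          \<and> k_const \<alpha> \<rho> \<gamma> \<sigma> =
              2 * Gamma (\<sigma> / \<gamma>) / (\<gamma> * (2 * \<rho>) powr (\<sigma> / \<gamma>))
                * hurwitz_zeta (\<sigma> / \<gamma>) ((\<alpha> + \<rho>) / (2 * \<rho>))"
proof -
  interpret half_discrete \<alpha> \<rho> \<gamma> \<sigma> \<delta> p q \<mu> \<nu> \<nu>t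
    by (rule half_discrete.intro) fact+
  have "integrable (lebesgue_on {0<..}) (\<lambda>x. H x n * f x)" if "f \<in> wLp p \<Phi>" "1 \<le> n" for f n
    using T1_bounded(1)[OF that(1), of "n - 1"] that(2) by simp
  then show ?thesis
    unfolding Let_def
    using T1_bounded(2) T2_bounded(1,2) T1_norm_eq T2_norm_eq
      k_const_eq[OF kernel_params(1-4)] by (simp add: K_def)
qed

end
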